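(* Let $R$ be a commutative Noetherian local ring, let $I$ be an ideal of $R$, let $M=R/I$ and let $t=\operatorname{depth} M$. Assume that $\operatorname{Ass}(R)\subseteq\operatorname{Ass}(M)=\operatorname{Min}(M)$. If $\operatorname{Ext}^i_R(M,M)=0$ for all $1\le i\le\max\{1,t\}$, then $M$ is free.
   Context: $\operatorname{Min}(M)$ denotes the set of minimal elements of $\operatorname{Supp}(M)$. *)

theory Defs
  imports "HOL-Algebra.Ring_Divisibility" "HOL-Algebra.Module" "HOL-Library.Extended_Nat"
begin

text \<open>
  Modules are records of type \<open>module\<close> as in \<open>HOL-Algebra.Module\<close>. That record type extends
  \<open>ring\<close>, but the locale \<open>module\<close> never looks at the fields \<open>mult\<close> and \<open>one\<close>; they are
  \<open>undefined\<close> below wherever there is no natural choice.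
\<close>

section \<open>Local rings, quotients, free modules, homomorphisms\<close>

definition local_ring :: "('a, 'x) ring_scheme \<Rightarrow> bool" where
  "local_ring R \<longleftrightarrow> cring R \<and> (\<exists>!m. maximalideal m R)"

definition max_ideal :: "('a, 'x) ring_scheme \<Rightarrow> 'a set" where
  "max_ideal R = (THE m. maximalideal m R)"

definition self_module :: "('a, 'x) ring_scheme \<Rightarrow> ('a, 'a) module" where
  "self_module R = \<lparr>carrier = carrier R, monoid.mult = monoid.mult R, monoid.one = monoid.one R,
     ring.zero = ring.zero R, ring.add = ring.add R,
     smult = monoid.mult R\<rparr>"

text \<open>The ring part is that of \<open>FactRing\<close>, so \<open>quot_module (self_module R) I\<close> is \<open>R Quot I\<close>
  together with its \<open>R\<close>-module structure.\<close>

definition quot_module :: "('a, 'm, 'y) module_scheme \<Rightarrow> 'm set \<Rightarrow> ('a, 'm set) module" where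
  "quot_module M N = \<lparr>carrier = a_rcosets\<^bsub>M\<^esub> N, monoid.mult = rcoset_mult M N, monoid.one = N +>\<^bsub>M\<^esub> \<one>\<^bsub>M\<^esub>,
     ring.zero = N, ring.add = set_add M, smult = (\<lambda>r U. \<Union>x\<in>U. N +>\<^bsub>M\<^esub> (r \<odot>\<^bsub>M\<^esub> x))\<rparr>"

definition zero_module :: "('a, 'm, 'y) module_scheme \<Rightarrow> bool" where
  "zero_module M \<longleftrightarrow> carrier M = {\<zero>\<^bsub>M\<^esub>}"

definition module_homs ::
  "('a, 'x) ring_scheme \<Rightarrow> ('a, 'm, 'y) module_scheme \<Rightarrow> ('a, 'n, 'z) module_scheme \<Rightarrow> ('m \<Rightarrow> 'n) set"
  where
  "module_homs R M N = {h \<in> carrier M \<rightarrow> carrier N.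
     (\<forall>x\<in>carrier M. \<forall>y\<in>carrier M. h (x \<oplus>\<^bsub>M\<^esub> y) = h x \<oplus>\<^bsub>N\<^esub> h y) \<and>
     (\<forall>r\<in>carrier R. \<forall>x\<in>carrier M. h (r \<odot>\<^bsub>M\<^esub> x) = r \<odot>\<^bsub>N\<^esub> h x)}"

text \<open>Homomorphisms as elements of a module have to be extensional.\<close>

definition Hom_module ::
  "('a, 'x) ring_scheme \<Rightarrow> ('a, 'm, 'y) module_scheme \<Rightarrow> ('a, 'n, 'z) module_scheme
    \<Rightarrow> ('a, 'm \<Rightarrow> 'n) module" where
  "Hom_module R M N = \<lparr>carrier = module_homs R M N \<inter> extensional (carrier M),
     monoid.mult = undefined, monoid.one = undefined,
     ring.zero = (\<lambda>x\<in>carrier M. \<zero>\<^bsub>N\<^esub>),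
     ring.add = (\<lambda>f g. \<lambda>x\<in>carrier M. f x \<oplus>\<^bsub>N\<^esub> g x),
     smult = (\<lambda>r f. \<lambda>x\<in>carrier M. r \<odot>\<^bsub>N\<^esub> f x)\<rparr>"

definition supp :: "('a, 'x) ring_scheme \<Rightarrow> ('b \<Rightarrow> 'a) \<Rightarrow> 'b set" where
  "supp R f = {b. f b \<noteq> \<zero>\<^bsub>R\<^esub>}"

text \<open>\<open>R\<^sup>(\<^sup>B\<^sup>)\<close>: finitely supported coefficient functions, extended by zero outside \<open>B\<close>.\<close>

definition free_mod :: "('a, 'x) ring_scheme \<Rightarrow> 'b set \<Rightarrow> ('a, 'b \<Rightarrow> 'a) module" where
  "free_mod R B = \<lparr>carrier = {f. range f \<subseteq> carrier R \<and> supp R f \<subseteq> B \<and> finite (supp R f)},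
     monoid.mult = undefined, monoid.one = undefined,
     ring.zero = (\<lambda>_. \<zero>\<^bsub>R\<^esub>),
     ring.add = (\<lambda>f g b. f b \<oplus>\<^bsub>R\<^esub> g b),
     smult = (\<lambda>r f b. r \<otimes>\<^bsub>R\<^esub> f b)\<rparr>"

text \<open>The linear extension \<open>R\<^sup>(\<^sup>B\<^sup>) \<rightarrow> M\<close> of a map \<open>\<phi> : B \<rightarrow> M\<close>.\<close>

definition lin_ext ::
  "('a, 'x) ring_scheme \<Rightarrow> ('a, 'm, 'y) module_scheme \<Rightarrow> ('b \<Rightarrow> 'm) \<Rightarrow> ('b \<Rightarrow> 'a) \<Rightarrow> 'm" where
  "lin_ext R M \<phi> f = (\<Oplus>\<^bsub>M\<^esub>b\<in>supp R f. f b \<odot>\<^bsub>M\<^esub> \<phi> b)"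

text \<open>\<open>M\<close> has a basis.\<close>

definition free_module :: "('a, 'x) ring_scheme \<Rightarrow> ('a, 'm, 'y) module_scheme \<Rightarrow> bool" where
  "free_module R M \<longleftrightarrow>
     (\<exists>B\<subseteq>carrier M. bij_betw (lin_ext R M (\<lambda>b. b)) (carrier (free_mod R B)) (carrier M))"

section \<open>Associated primes and support\<close>

definition ann :: "('a, 'x) ring_scheme \<Rightarrow> ('a, 'm, 'y) module_scheme \<Rightarrow> 'm \<Rightarrow> 'a set" where
  "ann R M x = {r \<in> carrier R. r \<odot>\<^bsub>M\<^esub> x = \<zero>\<^bsub>M\<^esub>}"

definition Ass :: "('a, 'x) ring_scheme \<Rightarrow> ('a, 'm, 'y) module_scheme \<Rightarrow> 'a set set" where
  "Ass R M = {p. primeideal p R \<and> (\<exists>x\<in>carrier M. p = ann R M x)}"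

definition frac_rel ::
  "('a, 'x) ring_scheme \<Rightarrow> ('a, 'm, 'y) module_scheme \<Rightarrow> 'a set \<Rightarrow> (('m \<times> 'a) \<times> ('m \<times> 'a)) set" where
  "frac_rel R M p = {((x, s), (y, t)). x \<in> carrier M \<and> y \<in> carrier M \<and>
     s \<in> carrier R - p \<and> t \<in> carrier R - p \<and>
     (\<exists>u\<in>carrier R - p. u \<odot>\<^bsub>M\<^esub> (t \<odot>\<^bsub>M\<^esub> x) = u \<odot>\<^bsub>M\<^esub> (s \<odot>\<^bsub>M\<^esub> y))}"

text \<open>The localization \<open>M\<^sub>p\<close>, with scalars restricted to \<open>R\<close>.\<close>

definition localized ::
  "('a, 'x) ring_scheme \<Rightarrow> ('a, 'm, 'y) module_scheme \<Rightarrow> 'a set \<Rightarrow> ('a, ('m \<times> 'a) set) module" where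
  "localized R M p = \<lparr>carrier = (carrier M \<times> (carrier R - p)) // frac_rel R M p,
     monoid.mult = undefined, monoid.one = undefined,
     ring.zero = frac_rel R M p `` {(\<zero>\<^bsub>M\<^esub>, \<one>\<^bsub>R\<^esub>)},
     ring.add = (\<lambda>U V. \<Union>(x, s)\<in>U. \<Union>(y, t)\<in>V.
       frac_rel R M p `` {(t \<odot>\<^bsub>M\<^esub> x \<oplus>\<^bsub>M\<^esub> s \<odot>\<^bsub>M\<^esub> y, s \<otimes>\<^bsub>R\<^esub> t)}),
     smult = (\<lambda>r U. \<Union>(x, s)\<in>U. frac_rel R M p `` {(r \<odot>\<^bsub>M\<^esub> x, s)})\<rparr>"

definition Supp :: "('a, 'x) ring_scheme \<Rightarrow> ('a, 'm, 'y) module_scheme \<Rightarrow> 'a set set" where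
  "Supp R M = {p. primeideal p R \<and> \<not> zero_module (localized R M p)}"

definition MinSupp :: "('a, 'x) ring_scheme \<Rightarrow> ('a, 'm, 'y) module_scheme \<Rightarrow> 'a set set" where
  "MinSupp R M = {p \<in> Supp R M. \<forall>q\<in>Supp R M. q \<subseteq> p \<longrightarrow> q = p}"

section \<open>Depth\<close>

definition ideal_times ::
  "('a, 'x) ring_scheme \<Rightarrow> 'a set \<Rightarrow> ('a, 'm, 'y) module_scheme \<Rightarrow> 'm set" where
  "ideal_times R J M = \<Inter>{N. submodule N R M \<and> (\<forall>a\<in>J. \<forall>x\<in>carrier M. a \<odot>\<^bsub>M\<^esub> x \<in> N)}"

definition mod_seq ::
  "('a, 'x) ring_scheme \<Rightarrow> ('a, 'm, 'y) module_scheme \<Rightarrow> 'a list \<Rightarrow> ('a, 'm set) module" where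
  "mod_seq R M xs = quot_module M (ideal_times R (Idl\<^bsub>R\<^esub> (set xs)) M)"

definition nonzerodivisor_on :: "('a, 'm, 'y) module_scheme \<Rightarrow> 'a \<Rightarrow> bool" where
  "nonzerodivisor_on M a \<longleftrightarrow> (\<forall>x\<in>carrier M. a \<odot>\<^bsub>M\<^esub> x = \<zero>\<^bsub>M\<^esub> \<longrightarrow> x = \<zero>\<^bsub>M\<^esub>)"

definition regular_seq ::
  "('a, 'x) ring_scheme \<Rightarrow> ('a, 'm, 'y) module_scheme \<Rightarrow> 'a list \<Rightarrow> bool" where
  "regular_seq R M xs \<longleftrightarrow> set xs \<subseteq> carrier R \<and>
     (\<forall>i<length xs. nonzerodivisor_on (mod_seq R M (take i xs)) (xs ! i)) \<and>
     \<not> zero_module (mod_seq R M xs)"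

text \<open>Depth over a local ring; the zero module has infinite depth by convention.\<close>

definition depth :: "('a, 'x) ring_scheme \<Rightarrow> ('a, 'm, 'y) module_scheme \<Rightarrow> enat" where
  "depth R M = (if zero_module M then \<infinity>
     else Sup {enat (length xs) | xs. set xs \<subseteq> max_ideal R \<and> regular_seq R M xs})"

section \<open>Ext\<close>

definition free_resolution ::
  "('a, 'x) ring_scheme \<Rightarrow> ('a, 'm, 'y) module_scheme
    \<Rightarrow> (nat \<Rightarrow> ('a, 'f, 'z) module_scheme) \<Rightarrow> (nat \<Rightarrow> 'f \<Rightarrow> 'f) \<Rightarrow> ('f \<Rightarrow> 'm) \<Rightarrow> bool" where
  "free_resolution R M F d \<epsilon> \<longleftrightarrow>
     (\<forall>n. module R (F n) \<and> free_module R (F n) \<and> d n \<in> module_homs R (F (Suc n)) (F n)) \<and>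
     \<epsilon> \<in> module_homs R (F 0) M \<and>
     \<epsilon> ` carrier (F 0) = carrier M \<and>
     d 0 ` carrier (F 1) = {f \<in> carrier (F 0). \<epsilon> f = \<zero>\<^bsub>M\<^esub>} \<and>
     (\<forall>n. d (Suc n) ` carrier (F (Suc (Suc n))) = {f \<in> carrier (F (Suc n)). d n f = \<zero>\<^bsub>F n\<^esub>})"

text \<open>The cohomology of the complex \<open>Hom(F\<^sub>0, N) \<rightarrow> Hom(F\<^sub>1, N) \<rightarrow> \<dots>\<close>, where \<open>d n : F\<^sub>n\<^sub>+\<^sub>1 \<rightarrow> F\<^sub>n\<close>.\<close>

definition codiff ::
  "(nat \<Rightarrow> ('a, 'f, 'z) module_scheme) \<Rightarrow> (nat \<Rightarrow> 'f \<Rightarrow> 'f) \<Rightarrow> nat \<Rightarrow> ('f \<Rightarrow> 'n) \<Rightarrow> ('f \<Rightarrow> 'n)" where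
  "codiff F d n h = compose (carrier (F (Suc n))) h (d n)"

definition cocycles ::
  "('a, 'x) ring_scheme \<Rightarrow> (nat \<Rightarrow> ('a, 'f, 'z) module_scheme) \<Rightarrow> (nat \<Rightarrow> 'f \<Rightarrow> 'f)
    \<Rightarrow> ('a, 'n, 'w) module_scheme \<Rightarrow> nat \<Rightarrow> ('f \<Rightarrow> 'n) set" where
  "cocycles R F d N n =
     {h \<in> carrier (Hom_module R (F n) N). codiff F d n h = \<zero>\<^bsub>Hom_module R (F (Suc n)) N\<^esub>}"

primrec coboundaries ::
  "('a, 'x) ring_scheme \<Rightarrow> (nat \<Rightarrow> ('a, 'f, 'z) module_scheme) \<Rightarrow> (nat \<Rightarrow> 'f \<Rightarrow> 'f)
    \<Rightarrow> ('a, 'n, 'w) module_scheme \<Rightarrow> nat \<Rightarrow> ('f \<Rightarrow> 'n) set" where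
  "coboundaries R F d N 0 = {\<zero>\<^bsub>Hom_module R (F 0) N\<^esub>}"
| "coboundaries R F d N (Suc n) = codiff F d n ` carrier (Hom_module R (F n) N)"

definition Hom_cohomology ::
  "('a, 'x) ring_scheme \<Rightarrow> (nat \<Rightarrow> ('a, 'f, 'z) module_scheme) \<Rightarrow> (nat \<Rightarrow> 'f \<Rightarrow> 'f)
    \<Rightarrow> ('a, 'n, 'w) module_scheme \<Rightarrow> nat \<Rightarrow> ('a, ('f \<Rightarrow> 'n) set) module" where
  "Hom_cohomology R F d N n =
     quot_module ((Hom_module R (F n) N)\<lparr>carrier := cocycles R F d N n\<rparr>) (coboundaries R F d N n)"

text \<open>
  Ext is computed from a canonical free resolution, available for every module over every
  commutative ring: \<open>F\<^sub>0\<close> is free on the elements of \<open>M\<close>, and \<open>F\<^sub>n\<^sub>+\<^sub>1\<close> is free on the cycles of \<open>F\<^sub>n\<close>.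
  So that all \<open>F\<^sub>n\<close> share one type, a cycle is represented by a formal linear combination of
  generators of \<open>F\<^sub>n\<close>; several such lists may represent the same cycle, which merely
  repeats generators. \<open>canonical_free_resolution\<close> below shows that this is a free resolution.
\<close>

datatype ('a, 'm) res_gen = Gen (gen_val: 'm) | Rel (rel_val: "('a \<times> ('a, 'm) res_gen) list")

fun lincomb :: "('a, 'x) ring_scheme \<Rightarrow> ('a \<times> 'b) list \<Rightarrow> 'b \<Rightarrow> 'a" where
  "lincomb R [] = (\<lambda>_. \<zero>\<^bsub>R\<^esub>)"
| "lincomb R ((a, b) # xs) = (\<lambda>c. if c = b then a \<oplus>\<^bsub>R\<^esub> lincomb R xs c else lincomb R xs c)"

definition res_aug ::
  "('a, 'x) ring_scheme \<Rightarrow> ('a, 'm, 'y) module_scheme \<Rightarrow> (('a, 'm) res_gen \<Rightarrow> 'a) \<Rightarrow> 'm" where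
  "res_aug R M = lin_ext R M gen_val"

definition res_diff ::
  "('a, 'x) ring_scheme \<Rightarrow> (('a, 'm) res_gen \<Rightarrow> 'a) \<Rightarrow> (('a, 'm) res_gen \<Rightarrow> 'a)" where
  "res_diff R = lin_ext R (free_mod R UNIV) (\<lambda>b. lincomb R (rel_val b))"

primrec res_gens ::
  "('a, 'x) ring_scheme \<Rightarrow> ('a, 'm, 'y) module_scheme \<Rightarrow> nat \<Rightarrow> ('a, 'm) res_gen set" where
  "res_gens R M 0 = Gen ` carrier M"
| "res_gens R M (Suc n) = Rel ` {xs. set xs \<subseteq> carrier R \<times> res_gens R M n \<and>
     (if n = 0 then res_aug R M (lincomb R xs) = \<zero>\<^bsub>M\<^esub>
      else res_diff R (lincomb R xs) = (\<lambda>_. \<zero>\<^bsub>R\<^esub>))}"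

definition res_mod ::
  "('a, 'x) ring_scheme \<Rightarrow> ('a, 'm, 'y) module_scheme \<Rightarrow> nat \<Rightarrow> ('a, ('a, 'm) res_gen \<Rightarrow> 'a) module"
  where
  "res_mod R M n = free_mod R (res_gens R M n)"

definition Ext ::
  "('a, 'x) ring_scheme \<Rightarrow> nat \<Rightarrow> ('a, 'm, 'y) module_scheme \<Rightarrow> ('a, 'n, 'w) module_scheme
    \<Rightarrow> ('a, (((('a, 'm) res_gen \<Rightarrow> 'a) \<Rightarrow> 'n)) set) module" where
  "Ext R i M N = Hom_cohomology R (res_mod R M) (\<lambda>_. res_diff R) N i"

subsection \<open>The canonical resolution is a free resolution\<close>

lemma supp_free_mod:
  assumes "f \<in> carrier (free_mod R B)"
  shows "finite (supp R f)" "supp R f \<subseteq> B" "f b \<in> carrier R"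
  using assms by (auto simp: free_mod_def)

lemma free_mod_simps [simp]:
  "\<zero>\<^bsub>free_mod R B\<^esub> = (\<lambda>_. \<zero>\<^bsub>R\<^esub>)"
  "f \<oplus>\<^bsub>free_mod R B\<^esub> g = (\<lambda>b. f b \<oplus>\<^bsub>R\<^esub> g b)"
  "r \<odot>\<^bsub>free_mod R B\<^esub> f = (\<lambda>b. r \<otimes>\<^bsub>R\<^esub> f b)"
  by (simp_all add: free_mod_def)

lemma free_modI:
  assumes "\<And>b. f b \<in> carrier R" "\<And>b. b \<notin> A \<Longrightarrow> f b = \<zero>\<^bsub>R\<^esub>" "finite A" "A \<subseteq> B"
  shows "f \<in> carrier (free_mod R B)"
proof -
  have "supp R f \<subseteq> A" using assms(2) by (auto simp: supp_def)
  then show ?thesis using assms by (auto simp: free_mod_def intro: finite_subset)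
qed

lemma free_mod_mono:
  assumes "f \<in> carrier (free_mod R B)" "B \<subseteq> C"
  shows "f \<in> carrier (free_mod R C)"
  using assms by (auto simp: free_mod_def)

lemma free_mod_add:
  assumes "cring R" "f \<in> carrier (free_mod R B)" "g \<in> carrier (free_mod R B)"
  shows "(\<lambda>b. f b \<oplus>\<^bsub>R\<^esub> g b) \<in> carrier (free_mod R B)"
proof -
  interpret cring R by fact
  show ?thesis
    by (rule free_modI[where A = "supp R f \<union> supp R g"])
      (use supp_free_mod[OF assms(2)] supp_free_mod[OF assms(3)] in \<open>auto simp: supp_def\<close>)
qed

lemma free_mod_smult:
  assumes "cring R" "f \<in> carrier (free_mod R B)" "r \<in> carrier R"
  shows "(\<lambda>b. r \<otimes>\<^bsub>R\<^esub> f b) \<in> carrier (free_mod R B)"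
proof -
  interpret cring R by fact
  show ?thesis
    by (rule free_modI[where A = "supp R f"])
      (use supp_free_mod[OF assms(2)] assms(3) in \<open>auto simp: supp_def\<close>)
qed

lemma free_mod_zero:
  assumes "cring R"
  shows "(\<lambda>_. \<zero>\<^bsub>R\<^esub>) \<in> carrier (free_mod R B)"
proof -
  interpret cring R by fact
  show ?thesis by (rule free_modI[where A = "{}"]) auto
qed

lemma module_free_mod:
  assumes "cring R"
  shows "module R (free_mod R B)"
proof -
  interpret cring R by fact
  note mem = supp_free_mod(3)
  show ?thesis
  proof (rule moduleI)
    show "abelian_group (free_mod R B)"
    proof (rule abelian_groupI)
      fix x assume x: "x \<in> carrier (free_mod R B)"
      have "(\<lambda>b. \<ominus>\<^bsub>R\<^esub> x b) \<in> carrier (free_mod R B)"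
        by (rule free_modI[where A = "supp R x"])
          (use supp_free_mod[OF x] in \<open>auto simp: supp_def\<close>)
      then show "\<exists>y\<in>carrier (free_mod R B). y \<oplus>\<^bsub>free_mod R B\<^esub> x = \<zero>\<^bsub>free_mod R B\<^esub>"
        using mem[OF x] by (auto intro!: bexI[of _ "\<lambda>b. \<ominus>\<^bsub>R\<^esub> x b"] simp: l_neg)
    qed (auto simp: fun_eq_iff mem a_ac intro: free_mod_add[OF assms] free_mod_zero[OF assms])
  qed (auto simp: fun_eq_iff mem l_distr r_distr m_assoc assms intro: free_mod_smult[OF assms])
qed

lemma lin_ext_superset:
  assumes "module R M" "f \<in> carrier (free_mod R B)" "\<phi> \<in> B \<rightarrow> carrier M"
    and "supp R f \<subseteq> A" "finite A" "A \<subseteq> B"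
  shows "lin_ext R M \<phi> f = (\<Oplus>\<^bsub>M\<^esub>b\<in>A. f b \<odot>\<^bsub>M\<^esub> \<phi> b)"
proof -
  interpret module R M by fact
  have c: "f b \<odot>\<^bsub>M\<^esub> \<phi> b \<in> carrier M" if "b \<in> A" for b
    using that assms(3,6) supp_free_mod(3)[OF assms(2)] by blast
  show ?thesis unfolding lin_ext_def
  proof (rule M.add.finprod_mono_neutral_cong_left)
    fix i assume "i \<in> A - supp R f"
    then have "\<phi> i \<in> carrier M" "f i = \<zero>\<^bsub>R\<^esub>" using assms(3,6) by (auto simp: supp_def)
    then show "f i \<odot>\<^bsub>M\<^esub> \<phi> i = \<zero>\<^bsub>M\<^esub>" by (metis smult_l_null)
  qed (use assms(4,5) c in auto)
qed

lemma lin_ext_hom: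
  assumes "module R M" "\<phi> \<in> B \<rightarrow> carrier M"
  shows "lin_ext R M \<phi> \<in> module_homs R (free_mod R B) M"
proof -
  interpret module R M by fact
  have cr: "cring R" by unfold_locales
  note mem = supp_free_mod(3)
  note sup = lin_ext_superset[OF assms(1) _ assms(2)]
  show ?thesis unfolding module_homs_def
  proof (intro CollectI conjI ballI funcsetI)
    fix f assume f: "f \<in> carrier (free_mod R B)"
    show "lin_ext R M \<phi> f \<in> carrier M" unfolding lin_ext_def
      using assms(2) supp_free_mod[OF f] by (intro M.finsum_closed) auto
  next
    fix f g assume f: "f \<in> carrier (free_mod R B)" and g: "g \<in> carrier (free_mod R B)"
    let ?A = "supp R f \<union> supp R g"
    have A: "finite ?A" "?A \<subseteq> B" using supp_free_mod[OF f] supp_free_mod[OF g] by auto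
    have s: "supp R (\<lambda>b. f b \<oplus>\<^bsub>R\<^esub> g b) \<subseteq> ?A" by (auto simp: supp_def)
    have c: "\<phi> b \<in> carrier M" if "b \<in> ?A" for b using that A assms(2) by auto
    have "lin_ext R M \<phi> (f \<oplus>\<^bsub>free_mod R B\<^esub> g) = (\<Oplus>\<^bsub>M\<^esub>b\<in>?A. (f b \<oplus>\<^bsub>R\<^esub> g b) \<odot>\<^bsub>M\<^esub> \<phi> b)"
      using sup[OF free_mod_add[OF cr f g] s A] by simp
    also have "\<dots> = (\<Oplus>\<^bsub>M\<^esub>b\<in>?A. f b \<odot>\<^bsub>M\<^esub> \<phi> b \<oplus>\<^bsub>M\<^esub> g b \<odot>\<^bsub>M\<^esub> \<phi> b)"
      by (intro M.finsum_cong') (use c mem[OF f] mem[OF g] in \<open>auto simp: smult_l_distr\<close>)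
    also have "\<dots> = (\<Oplus>\<^bsub>M\<^esub>b\<in>?A. f b \<odot>\<^bsub>M\<^esub> \<phi> b) \<oplus>\<^bsub>M\<^esub> (\<Oplus>\<^bsub>M\<^esub>b\<in>?A. g b \<odot>\<^bsub>M\<^esub> \<phi> b)"
      by (intro M.finsum_addf) (use c mem[OF f] mem[OF g] in auto)
    also have "\<dots> = lin_ext R M \<phi> f \<oplus>\<^bsub>M\<^esub> lin_ext R M \<phi> g"
      using sup[OF f _ A] sup[OF g _ A] by simp
    finally show "lin_ext R M \<phi> (f \<oplus>\<^bsub>free_mod R B\<^esub> g) = lin_ext R M \<phi> f \<oplus>\<^bsub>M\<^esub> lin_ext R M \<phi> g" .
  next
    fix r f assume r: "r \<in> carrier R" and f: "f \<in> carrier (free_mod R B)"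
    let ?A = "supp R f"
    have A: "finite ?A" "?A \<subseteq> B" using supp_free_mod[OF f] by auto
    have s: "supp R (\<lambda>b. r \<otimes>\<^bsub>R\<^esub> f b) \<subseteq> ?A" using r by (auto simp: supp_def)
    have c: "\<phi> b \<in> carrier M" if "b \<in> ?A" for b using that A assms(2) by auto
    have "lin_ext R M \<phi> (r \<odot>\<^bsub>free_mod R B\<^esub> f) = (\<Oplus>\<^bsub>M\<^esub>b\<in>?A. (r \<otimes>\<^bsub>R\<^esub> f b) \<odot>\<^bsub>M\<^esub> \<phi> b)"
      using sup[OF free_mod_smult[OF cr f r] s A] by simp
    also have "\<dots> = (\<Oplus>\<^bsub>M\<^esub>b\<in>?A. r \<odot>\<^bsub>M\<^esub> (f b \<odot>\<^bsub>M\<^esub> \<phi> b))"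
      by (intro M.finsum_cong') (use c mem[OF f] r in \<open>auto simp: smult_assoc1\<close>)
    also have "\<dots> = r \<odot>\<^bsub>M\<^esub> lin_ext R M \<phi> f" unfolding lin_ext_def
      using A r c mem[OF f] by (subst finsum_smult_ldistr) auto
    finally show "lin_ext R M \<phi> (r \<odot>\<^bsub>free_mod R B\<^esub> f) = r \<odot>\<^bsub>M\<^esub> lin_ext R M \<phi> f" .
  qed
qed

lemma module_homs_zero:
  assumes "module R M" "module R N" "h \<in> module_homs R M N"
  shows "h \<zero>\<^bsub>M\<^esub> = \<zero>\<^bsub>N\<^esub>"
proof -
  interpret M: module R M by fact
  interpret N: module R N by fact
  have "h (\<zero>\<^bsub>R\<^esub> \<odot>\<^bsub>M\<^esub> \<zero>\<^bsub>M\<^esub>) = \<zero>\<^bsub>R\<^esub> \<odot>\<^bsub>N\<^esub> h \<zero>\<^bsub>M\<^esub>" "h \<zero>\<^bsub>M\<^esub> \<in> carrier N"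
    using assms(3) M.zero_closed M.R.zero_closed unfolding module_homs_def by blast+
  then show ?thesis by (metis M.smult_l_null N.smult_l_null M.zero_closed)
qed

text \<open>A homomorphism that kills the values of \<open>\<phi>\<close> kills the image of its linear extension.\<close>

lemma hom_lin_ext_zero:
  assumes "module R M" "module R N" "h \<in> module_homs R M N"
    and "f \<in> carrier (free_mod R B)" "\<And>b. b \<in> B \<Longrightarrow> \<phi> b \<in> carrier M \<and> h (\<phi> b) = \<zero>\<^bsub>N\<^esub>"
  shows "h (lin_ext R M \<phi> f) = \<zero>\<^bsub>N\<^esub>"
proof -
  interpret M: module R M by fact
  interpret N: module R N by fact
  note mem = supp_free_mod[OF assms(4)]
  have "h (\<Oplus>\<^bsub>M\<^esub>b\<in>A. f b \<odot>\<^bsub>M\<^esub> \<phi> b) = \<zero>\<^bsub>N\<^esub>" if "finite A" "A \<subseteq> B" for A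
    using that
  proof (induction A)
    case empty
    then show ?case using module_homs_zero[OF assms(1-3)] by simp
  next
    case (insert b A)
    have c: "(\<lambda>b. f b \<odot>\<^bsub>M\<^esub> \<phi> b) \<in> A \<rightarrow> carrier M" "f b \<odot>\<^bsub>M\<^esub> \<phi> b \<in> carrier M"
      using insert.prems assms(5) mem(3) by auto
    have "h (f b \<odot>\<^bsub>M\<^esub> \<phi> b) = \<zero>\<^bsub>N\<^esub>"
      using assms(3,5) insert.prems mem(3) by (auto simp: module_homs_def)
    then show ?case
      using insert c assms(3) by (auto simp: module_homs_def)
  qed
  then show ?thesis using mem unfolding lin_ext_def by blast
qed

definition unit_vec :: "('a, 'x) ring_scheme \<Rightarrow> 'b \<Rightarrow> 'b \<Rightarrow> 'a" where
  "unit_vec R b = (\<lambda>c. if c = b then \<one>\<^bsub>R\<^esub> else \<zero>\<^bsub>R\<^esub>)"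

lemma unit_vec_carrier:
  assumes "cring R" "b \<in> B"
  shows "unit_vec R b \<in> carrier (free_mod R B)"
proof -
  interpret cring R by fact
  show ?thesis by (rule free_modI[where A = "{b}"]) (use assms in \<open>auto simp: unit_vec_def\<close>)
qed

lemma lin_ext_unit_vec:
  assumes "module R M" "b \<in> B" "\<phi> b \<in> carrier M"
  shows "lin_ext R M \<phi> (unit_vec R b) = \<phi> b"
proof -
  interpret module R M by fact
  have "lin_ext R M \<phi> (unit_vec R b) = (\<Oplus>\<^bsub>M\<^esub>c\<in>{b}. unit_vec R b c \<odot>\<^bsub>M\<^esub> \<phi> c)"
    by (rule lin_ext_superset[OF assms(1) unit_vec_carrier[of R b "{b}"]])
      (use assms(3) is_cring in \<open>auto simp: supp_def unit_vec_def split: if_splits\<close>)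
  then show ?thesis using assms by (simp add: unit_vec_def)
qed

lemma lincomb_carrier:
  assumes "cring R" "set xs \<subseteq> carrier R \<times> B"
  shows "lincomb R xs \<in> carrier (free_mod R B)"
proof -
  interpret cring R by fact
  have "(\<forall>b. lincomb R xs b \<in> carrier R) \<and> (\<forall>b. b \<notin> snd ` set xs \<longrightarrow> lincomb R xs b = \<zero>\<^bsub>R\<^esub>)"
    using assms(2) by (induction xs) auto
  then show ?thesis using assms(2) by (intro free_modI[where A = "snd ` set xs"]) auto
qed

lemma lincomb_surj:
  assumes "cring R" "f \<in> carrier (free_mod R B)"
  obtains xs where "set xs \<subseteq> carrier R \<times> B" "lincomb R xs = f"
proof -
  interpret cring R by fact
  note mem = supp_free_mod[OF assms(2)]
  obtain bs where bs: "set bs = supp R f" "distinct bs"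
    using finite_distinct_list[OF mem(1)] by blast
  have *: "lincomb R (map (\<lambda>b. (f b, b)) bs) c = (if c \<in> set bs then f c else \<zero>\<^bsub>R\<^esub>)" for c
    using \<open>distinct bs\<close> by (induction bs) (auto simp: mem(3))
  show thesis
    by (rule that[of "map (\<lambda>b. (f b, b)) bs"]) (use * mem bs in \<open>auto simp: supp_def\<close>)
qed

lemma finsum_free_mod_apply:
  assumes "cring R" "finite A" "g \<in> A \<rightarrow> carrier (free_mod R B)"
  shows "(\<Oplus>\<^bsub>free_mod R B\<^esub>i\<in>A. g i) c = (\<Oplus>\<^bsub>R\<^esub>i\<in>A. g i c)"
proof -
  interpret cring R by fact
  interpret F: module R "free_mod R B" using module_free_mod[OF assms(1)] .
  from assms(2,3) show ?thesis
  proof (induction A)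
    case (insert i A)
    have "(\<lambda>i. g i c) \<in> A \<rightarrow> carrier R" "g i c \<in> carrier R"
      using insert.prems supp_free_mod(3)[of _ R B] by blast+
    moreover have "g \<in> A \<rightarrow> carrier (free_mod R B)" "g i \<in> carrier (free_mod R B)"
      using insert.prems by blast+
    ultimately show ?case using insert by simp
  qed simp
qed

lemma lin_ext_free_mod_apply:
  assumes "cring R" "f \<in> carrier (free_mod R B)" "\<phi> \<in> B \<rightarrow> carrier (free_mod R C)"
  shows "lin_ext R (free_mod R C) \<phi> f c = (\<Oplus>\<^bsub>R\<^esub>b\<in>supp R f. f b \<otimes>\<^bsub>R\<^esub> \<phi> b c)"
proof -
  note mem = supp_free_mod[OF assms(2)]
  have "lin_ext R (free_mod R C) \<phi> f c = (\<Oplus>\<^bsub>R\<^esub>b\<in>supp R f. (f b \<odot>\<^bsub>free_mod R C\<^esub> \<phi> b) c)"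
    unfolding lin_ext_def
    by (rule finsum_free_mod_apply[OF assms(1) mem(1)])
      (use mem assms(3) in \<open>auto intro!: free_mod_smult[OF assms(1)]\<close>)
  then show ?thesis by simp
qed

lemma free_module_free_mod:
  fixes R :: "('a, 'x) ring_scheme" and B :: "'b set"
  assumes "cring R"
  shows "free_module R (free_mod R B)"
proof (cases "\<one>\<^bsub>R\<^esub> = \<zero>\<^bsub>R\<^esub>")
  case True
  interpret cring R by fact
  interpret F: module R "free_mod R B" by (rule module_free_mod[OF assms])
  have e: "carrier (free_mod R {}) = {\<lambda>_ :: 'b \<Rightarrow> 'a. \<zero>\<^bsub>R\<^esub>}"
  proof (intro equalityI subsetI)
    fix f :: "('b \<Rightarrow> 'a) \<Rightarrow> 'a"
    assume "f \<in> carrier (free_mod R {})"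
    then have "supp R f \<subseteq> {}" by (rule supp_free_mod(2))
    then show "f \<in> {\<lambda>_. \<zero>\<^bsub>R\<^esub>}" by (simp add: supp_def fun_eq_iff)
  qed (use free_mod_zero[OF assms] in blast)
  have B: "carrier (free_mod R B) = {\<lambda>_. \<zero>\<^bsub>R\<^esub>}"
  proof (intro equalityI subsetI)
    fix f assume "f \<in> carrier (free_mod R B)"
    then have "f b = \<zero>\<^bsub>R\<^esub>" for b
      using supp_free_mod(3)[of f R B b] one_zeroD[OF True] by blast
    then show "f \<in> {\<lambda>_. \<zero>\<^bsub>R\<^esub>}" by (simp add: fun_eq_iff)
  qed (use free_mod_zero[OF assms] in blast)
  have "lin_ext R (free_mod R B) (\<lambda>b. b) (\<lambda>_. \<zero>\<^bsub>R\<^esub>) = (\<lambda>_. \<zero>\<^bsub>R\<^esub>)"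
    using F.finsum_empty by (simp add: lin_ext_def supp_def)
  then have "bij_betw (lin_ext R (free_mod R B) (\<lambda>b. b)) (carrier (free_mod R {}))
      (carrier (free_mod R B))"
    unfolding e B by (simp add: bij_betw_def)
  then show ?thesis
    unfolding free_module_def by blast
next
  case False
  interpret cring R by fact
  let ?U = "unit_vec R ` B" and ?l = "lin_ext R (free_mod R B) (\<lambda>b. b)"
  have inj: "inj (unit_vec R :: 'b \<Rightarrow> 'b \<Rightarrow> 'a)"
  proof (rule injI)
    fix b c :: 'b assume "unit_vec R b = unit_vec R c"
    then have "unit_vec R b b = unit_vec R c b" by (rule fun_cong)
    then show "b = c" using False by (simp add: unit_vec_def split: if_splits)
  qed
  have U: "?U \<subseteq> carrier (free_mod R B)" using unit_vec_carrier[OF assms] by auto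
  have val: "?l f c = (if c \<in> B then f (unit_vec R c) else \<zero>\<^bsub>R\<^esub>)"
    if f: "f \<in> carrier (free_mod R ?U)" for f c
  proof -
    note mem = supp_free_mod[OF f]
    have "?l f c = (\<Oplus>\<^bsub>R\<^esub>u\<in>supp R f. f u \<otimes>\<^bsub>R\<^esub> u c)"
      by (rule lin_ext_free_mod_apply[OF assms f]) (use U in auto)
    also have "\<dots> = (\<Oplus>\<^bsub>R\<^esub>u\<in>supp R f. if unit_vec R c = u then f u else \<zero>\<^bsub>R\<^esub>)"
    proof (rule finsum_cong')
      fix u assume "u \<in> supp R f"
      then obtain b where b: "u = unit_vec R b" using mem(2) by auto
      show "f u \<otimes>\<^bsub>R\<^esub> u c = (if unit_vec R c = u then f u else \<zero>\<^bsub>R\<^esub>)"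
        using mem(3) inj by (auto simp: b inj_eq) (auto simp: unit_vec_def)
    qed (use mem in auto)
    also have "\<dots> = (if unit_vec R c \<in> supp R f then f (unit_vec R c) else \<zero>\<^bsub>R\<^esub>)"
    proof (cases "unit_vec R c \<in> supp R f")
      case True
      then show ?thesis using finsum_singleton[OF True mem(1), of f] mem(3) by auto
    next
      case False
      then have "(\<Oplus>\<^bsub>R\<^esub>u\<in>supp R f. if unit_vec R c = u then f u else \<zero>\<^bsub>R\<^esub>)
          = (\<Oplus>\<^bsub>R\<^esub>u\<in>supp R f. \<zero>\<^bsub>R\<^esub>)"
        by (intro finsum_cong') auto
      then show ?thesis using False by simp
    qed
    also have "\<dots> = (if c \<in> B then f (unit_vec R c) else \<zero>\<^bsub>R\<^esub>)"
      using mem(2) inj by (auto simp: supp_def inj_eq)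
    finally show ?thesis .
  qed
  have "bij_betw ?l (carrier (free_mod R ?U)) (carrier (free_mod R B))"
  proof (rule bij_betwI')
    fix f g assume f: "f \<in> carrier (free_mod R ?U)" and g: "g \<in> carrier (free_mod R ?U)"
    show "(?l f = ?l g) = (f = g)"
    proof
      assume e: "?l f = ?l g"
      show "f = g"
      proof
        fix u
        show "f u = g u"
        proof (cases "u \<in> ?U")
          case True
          then obtain b where "u = unit_vec R b" "b \<in> B" by auto
          then show ?thesis using fun_cong[OF e, of b] val[OF f] val[OF g] by simp
        next
          case False
          then have "u \<notin> supp R f" "u \<notin> supp R g"
            using supp_free_mod(2)[OF f] supp_free_mod(2)[OF g] by blast+
          then show ?thesis by (simp add: supp_def)
        qed
      qed
    qed simp
  next
    fix f assume "f \<in> carrier (free_mod R ?U)"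
    then show "?l f \<in> carrier (free_mod R B)"
      using lin_ext_hom[OF module_free_mod[OF assms], of "\<lambda>b. b" ?U B] U
      unfolding module_homs_def by blast
  next
    fix g assume g: "g \<in> carrier (free_mod R B)"
    note mem = supp_free_mod[OF g]
    define f where "f u = (if u \<in> ?U then g (inv_into B (unit_vec R) u) else \<zero>\<^bsub>R\<^esub>)" for u
    have fU: "f (unit_vec R b) = g b" if "b \<in> B" for b
      using that inj by (simp add: f_def inv_into_f_f[OF inj_on_subset[OF inj]])
    have f: "f \<in> carrier (free_mod R ?U)"
    proof (rule free_modI[where A = "unit_vec R ` supp R g"])
      show "f u \<in> carrier R" for u using mem(3) by (simp add: f_def)
      show "f u = \<zero>\<^bsub>R\<^esub>" if "u \<notin> unit_vec R ` supp R g" for u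
        using that fU by (cases "u \<in> ?U") (auto simp: supp_def, simp add: f_def)
    qed (use mem in auto)
    have "g = ?l f"
      using val[OF f] fU mem(2) by (auto simp: fun_eq_iff supp_def)
    then show "\<exists>f\<in>carrier (free_mod R ?U). g = ?l f" using f by blast
  qed
  then show ?thesis unfolding free_module_def using U by blast
qed

lemma res_rel_carrier:
  assumes "cring R" "b \<in> res_gens R M (Suc n)"
  shows "lincomb R (rel_val b) \<in> carrier (res_mod R M n)"
  using assms(2) lincomb_carrier[OF assms(1)] by (auto simp: res_mod_def)

lemma res_diff_eq:
  assumes "cring R" "f \<in> carrier (res_mod R M (Suc n))"
  shows "res_diff R f = lin_ext R (res_mod R M n) (\<lambda>b. lincomb R (rel_val b)) f"
proof
  fix c
  let ?\<phi> = "\<lambda>b. lincomb R (rel_val b)"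
  have p: "?\<phi> \<in> res_gens R M (Suc n) \<rightarrow> carrier (free_mod R (res_gens R M n))"
  proof
    fix b assume "b \<in> res_gens R M (Suc n)"
    then show "?\<phi> b \<in> carrier (free_mod R (res_gens R M n))"
      using res_rel_carrier[OF assms(1)] unfolding res_mod_def by blast
  qed
  have q: "?\<phi> \<in> res_gens R M (Suc n) \<rightarrow> carrier (free_mod R UNIV)"
  proof
    fix b assume "b \<in> res_gens R M (Suc n)"
    then show "?\<phi> b \<in> carrier (free_mod R UNIV)"
      using p free_mod_mono[of "?\<phi> b" R "res_gens R M n" UNIV] by blast
  qed
  have f: "f \<in> carrier (free_mod R (res_gens R M (Suc n)))"
    using assms(2) unfolding res_mod_def .
  show "res_diff R f c = lin_ext R (res_mod R M n) ?\<phi> f c"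
    unfolding res_diff_def res_mod_def
    using lin_ext_free_mod_apply[OF assms(1) f p, of c] lin_ext_free_mod_apply[OF assms(1) f q, of c]
    by (rule trans[OF _ sym, rotated])
qed

lemma res_diff_hom:
  assumes "cring R"
  shows "res_diff R \<in> module_homs R (res_mod R M (Suc n)) (res_mod R M n)"
proof -
  interpret F: module R "res_mod R M (Suc n)"
    unfolding res_mod_def by (rule module_free_mod[OF assms])
  have "lin_ext R (res_mod R M n) (\<lambda>b. lincomb R (rel_val b))
      \<in> module_homs R (res_mod R M (Suc n)) (res_mod R M n)"
    unfolding res_mod_def
  proof (rule lin_ext_hom[OF module_free_mod[OF assms]], rule funcsetI)
    fix b assume "b \<in> res_gens R M (Suc n)"
    then show "lincomb R (rel_val b) \<in> carrier (free_mod R (res_gens R M n))"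
      using res_rel_carrier[OF assms] unfolding res_mod_def by blast
  qed
  then show ?thesis
    using res_diff_eq[OF assms, of _ M n] by (auto simp: module_homs_def Pi_def)
qed

lemma res_diff_unit_vec:
  assumes "cring R" "b \<in> res_gens R M (Suc n)"
  shows "res_diff R (unit_vec R b) = lincomb R (rel_val b)"
proof -
  have "unit_vec R b \<in> carrier (res_mod R M (Suc n))"
    unfolding res_mod_def by (rule unit_vec_carrier[OF assms])
  moreover have "module R (res_mod R M n)"
    unfolding res_mod_def by (rule module_free_mod[OF assms(1)])
  ultimately show ?thesis
    using lin_ext_unit_vec[where \<phi> = "\<lambda>b. lincomb R (rel_val b)", OF _ assms(2) res_rel_carrier[OF assms]]
    by (subst res_diff_eq[OF assms(1)])
qed

lemma res_exact:
  assumes "cring R" "module R N" "h \<in> module_homs R (res_mod R M n) N"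
    and G: "\<And>xs. Rel xs \<in> res_gens R M (Suc n) \<longleftrightarrow>
      set xs \<subseteq> carrier R \<times> res_gens R M n \<and> h (lincomb R xs) = \<zero>\<^bsub>N\<^esub>"
  shows "res_diff R ` carrier (res_mod R M (Suc n)) = {f \<in> carrier (res_mod R M n). h f = \<zero>\<^bsub>N\<^esub>}"
proof (intro equalityI subsetI)
  fix g assume "g \<in> res_diff R ` carrier (res_mod R M (Suc n))"
  then obtain f where f: "f \<in> carrier (res_mod R M (Suc n))" "g = res_diff R f" by auto
  have rel: "lincomb R (rel_val b) \<in> carrier (res_mod R M n) \<and> h (lincomb R (rel_val b)) = \<zero>\<^bsub>N\<^esub>"
    if b: "b \<in> res_gens R M (Suc n)" for b
  proof -
    obtain xs where xs: "b = Rel xs" using b by auto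
    then have "h (lincomb R xs) = \<zero>\<^bsub>N\<^esub>" using G b by blast
    then show ?thesis using res_rel_carrier[OF assms(1) b] by (simp add: xs)
  qed
  have mod: "module R (res_mod R M n)"
    unfolding res_mod_def by (rule module_free_mod[OF assms(1)])
  have f': "f \<in> carrier (free_mod R (res_gens R M (Suc n)))"
    using f(1) unfolding res_mod_def .
  have "h g = \<zero>\<^bsub>N\<^esub>"
    unfolding f(2) res_diff_eq[OF assms(1) f(1)]
    by (rule hom_lin_ext_zero[OF mod assms(2,3) f' rel])
  then show "g \<in> {f \<in> carrier (res_mod R M n). h f = \<zero>\<^bsub>N\<^esub>}"
    using res_diff_hom[OF assms(1), of M n] f unfolding module_homs_def by blast
next
  fix f assume f: "f \<in> {f \<in> carrier (res_mod R M n). h f = \<zero>\<^bsub>N\<^esub>}"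
  then obtain xs where xs: "set xs \<subseteq> carrier R \<times> res_gens R M n" "lincomb R xs = f"
    using lincomb_surj[OF assms(1)] unfolding res_mod_def by blast
  then have b: "Rel xs \<in> res_gens R M (Suc n)" using G f by blast
  then have "unit_vec R (Rel xs) \<in> carrier (res_mod R M (Suc n))"
    unfolding res_mod_def by (rule unit_vec_carrier[OF assms(1)])
  then show "f \<in> res_diff R ` carrier (res_mod R M (Suc n))"
    using res_diff_unit_vec[OF assms(1) b] xs(2) by (intro image_eqI[of f]) simp_all
qed

theorem canonical_free_resolution:
  assumes "module R M"
  shows "free_resolution R M (res_mod R M) (\<lambda>_. res_diff R) (res_aug R M)"
proof -
  interpret module R M by fact
  have cr: "cring R" by unfold_locales
  have mod: "module R (res_mod R M n)" for n
    unfolding res_mod_def by (rule module_free_mod[OF cr])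
  have free: "free_module R (res_mod R M n)" for n
    unfolding res_mod_def by (rule free_module_free_mod[OF cr])
  have aug: "res_aug R M \<in> module_homs R (res_mod R M 0) M"
    unfolding res_aug_def res_mod_def by (rule lin_ext_hom[OF assms]) auto
  have "x \<in> res_aug R M ` carrier (res_mod R M 0)" if x: "x \<in> carrier M" for x
  proof (rule image_eqI)
    have g: "Gen x \<in> res_gens R M 0" using x by simp
    show "x = res_aug R M (unit_vec R (Gen x))"
      unfolding res_aug_def using lin_ext_unit_vec[OF assms g, of gen_val] x by simp
    show "unit_vec R (Gen x) \<in> carrier (res_mod R M 0)"
      unfolding res_mod_def by (rule unit_vec_carrier[OF cr g])
  qed
  then have surj: "res_aug R M ` carrier (res_mod R M 0) = carrier M"
    using aug by (auto simp: module_homs_def)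
  have ex0: "res_diff R ` carrier (res_mod R M (Suc 0))
      = {f \<in> carrier (res_mod R M 0). res_aug R M f = \<zero>\<^bsub>M\<^esub>}"
    by (rule res_exact[OF cr assms aug]) auto
  have ex: "res_diff R ` carrier (res_mod R M (Suc (Suc n)))
      = {f \<in> carrier (res_mod R M (Suc n)). res_diff R f = \<zero>\<^bsub>res_mod R M n\<^esub>}" for n
    by (rule res_exact[OF cr mod res_diff_hom[OF cr]]) (auto simp: res_mod_def)
  show ?thesis
    unfolding free_resolution_def
    using mod free res_diff_hom[OF cr] aug surj ex0 ex by auto
qed

end

theory Submission
  imports Defs
begin

text \<open>
  Since \<open>I\<close> kills \<open>R/I\<close>, the vanishing of \<open>Ext\<^sup>1(R/I, R/I)\<close> means \<open>Hom(I, R/I) = 0\<close>. If \<open>I \<noteq> 0\<close>, then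
  \<open>I\<close> contains an element whose annihilator is a prime \<open>p \<in> Ass R\<close>; by assumption \<open>p\<close> is also the
  annihilator of some \<open>x \<in> R/I\<close>. By Nakayama, the nonzero finitely generated module \<open>I\<^sub>p\<close> maps onto the
  residue field at \<open>p\<close>; clearing denominators yields a nonzero map \<open>I \<rightarrow> R/p \<cong> R x \<subseteq> R/I\<close>, a
  contradiction. Hence \<open>I = 0\<close>.
\<close>

section \<open>Associated primes of ideals\<close>

text \<open>Zorn's lemma applies because the Noetherian condition makes the union of a nonempty
  chain of ideals a member of that chain; for the empty chain any element of \<open>S\<close> is a
  bound.\<close>

lemma (in noetherian_ring) exists_maximal_ideal_in:
  assumes "S \<noteq> {}" "\<And>J. J \<in> S \<Longrightarrow> ideal J R"
  obtains J where "J \<in> S" "\<And>K. K \<in> S \<Longrightarrow> J \<subseteq> K \<Longrightarrow> K = J"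
proof -
  have "\<exists>J\<in>S. \<forall>K\<in>S. J \<subseteq> K \<longrightarrow> K = J"
  proof (rule subset_Zorn)
    fix C assume C: "subset.chain S C"
    show "\<exists>U\<in>S. \<forall>K\<in>C. K \<subseteq> U"
    proof (cases "C = {}")
      case False
      have "subset.chain {I. ideal I R} C"
        using C assms(2) unfolding pred_on.chain_def by auto
      then have "\<Union>C \<in> C" by (rule ideal_chain_is_trivial[OF False])
      moreover have "C \<subseteq> S" using C unfolding pred_on.chain_def by simp
      ultimately have "\<Union>C \<in> S" by (rule rev_subsetD)
      then show ?thesis by (meson Union_upper)
    qed (use assms(1) in auto)
  qed
  then show thesis using that by metis
qed

lemma ann_self_module: "ann R (self_module R) y = {r \<in> carrier R. r \<otimes>\<^bsub>R\<^esub> y = \<zero>\<^bsub>R\<^esub>}"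
  by (simp add: ann_def self_module_def)

text \<open>The annihilator of \<open>y\<close> is the colon ideal (0 : y), a case covered by
  \<open>helper_max_prime\<close>.\<close>

lemma (in cring) ideal_ann_self:
  assumes "y \<in> carrier R"
  shows "ideal (ann R (self_module R) y) R"
proof -
  interpret Z: ideal "{\<zero>}" R by (rule zeroideal)
  have "ann R (self_module R) y = {x \<in> carrier R. y \<otimes> x \<in> {\<zero>}}"
    using assms by (auto simp: ann_self_module m_comm)
  then show ?thesis using Z.helper_max_prime[OF is_cring assms] by simp
qed

text \<open>An ideal that is maximal among the annihilators of nonzero elements of \<open>I\<close>
  is prime.\<close>

lemma (in cring) exists_Ass_ideal:
  assumes "noetherian_ring R" "ideal I R" "I \<noteq> {\<zero>}"
  obtains y where "y \<in> I" "ann R (self_module R) y \<in> Ass R (self_module R)"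
proof -
  interpret N: noetherian_ring R by fact
  interpret I: ideal I R by fact
  let ?ann = "ann R (self_module R)"
  have c: "y \<in> carrier R" if "y \<in> I - {\<zero>}" for y using that I.Icarr by auto
  have "?ann ` (I - {\<zero>}) \<noteq> {}" using assms(3) I.zero_closed by auto
  then obtain J where J: "J \<in> ?ann ` (I - {\<zero>})"
      and max: "\<And>K. K \<in> ?ann ` (I - {\<zero>}) \<Longrightarrow> J \<subseteq> K \<Longrightarrow> K = J"
    by (rule N.exists_maximal_ideal_in) (use c ideal_ann_self in auto)
  then obtain y where y: "y \<in> I - {\<zero>}" "J = ?ann y" by auto
  note yc = c[OF y(1)]
  have "primeideal (?ann y) R"
  proof (rule primeidealI[OF ideal_ann_self[OF yc] is_cring])
    have "\<one> \<notin> ?ann y" using y(1) yc by (auto simp: ann_self_module)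
    then show "carrier R \<noteq> ?ann y" by auto
  next
    fix a b assume ab: "a \<in> carrier R" "b \<in> carrier R" "a \<otimes> b \<in> ?ann y"
    show "a \<in> ?ann y \<or> b \<in> ?ann y"
    proof (rule disjCI)
      assume "b \<notin> ?ann y"
      \<comment> \<open>The product \<open>b y\<close> is again a nonzero element of
        \<open>I\<close>, and its annihilator contains that of \<open>y\<close>. Maximality makes
        the two equal, and \<open>a\<close> kills \<open>b y\<close>.\<close>
      then have bI: "b \<otimes> y \<in> I - {\<zero>}"
        using ab y(1) I.I_l_closed by (auto simp: ann_self_module)
      have "?ann y \<subseteq> ?ann (b \<otimes> y)"
        using ab yc m_lcomm[of _ b y] by (auto simp: ann_self_module)
      then have "?ann (b \<otimes> y) = ?ann y" using max[of "?ann (b \<otimes> y)"] bI y(2) by blast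
      moreover have "a \<in> ?ann (b \<otimes> y)" using ab yc by (auto simp: ann_self_module m_assoc)
      ultimately show "a \<in> ?ann y" by simp
    qed
  qed
  then have "?ann y \<in> Ass R (self_module R)"
    using yc by (auto simp: Ass_def self_module_def)
  then show thesis using y(1) that by blast
qed

section \<open>A nonzero homomorphism out of an ideal\<close>

abbreviation ideal_module :: "('a, 'x) ring_scheme \<Rightarrow> 'a set \<Rightarrow> ('a, 'a) module" where
  "ideal_module R I \<equiv> (self_module R)\<lparr>carrier := I\<rparr>"

lemma module_homs_ideal_iff:
  "h \<in> module_homs R (ideal_module R I) N \<longleftrightarrow> h \<in> I \<rightarrow> carrier N \<and>
     (\<forall>x\<in>I. \<forall>y\<in>I. h (x \<oplus>\<^bsub>R\<^esub> y) = h x \<oplus>\<^bsub>N\<^esub> h y) \<and>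
     (\<forall>r\<in>carrier R. \<forall>x\<in>I. h (r \<otimes>\<^bsub>R\<^esub> x) = r \<odot>\<^bsub>N\<^esub> h x)"
  by (simp add: module_homs_def self_module_def)

text \<open>
  For \<open>J\<close> maximal among the ideals \<open>J \<subseteq> I\<close> with \<open>(I/J)\<^sub>p \<noteq> 0\<close> and \<open>z \<in> I - J\<close>, there is
  \<open>s \<notin> p\<close> with \<open>s I \<subseteq> J + R z\<close>, and \<open>(J : z) \<subseteq> p\<close>. The homomorphism sends \<open>w\<close> to \<open>r x\<close> where
  \<open>s w \<in> J + r z\<close>.
\<close>

lemma exists_nonzero_hom_from_ideal:
  assumes "noetherian_ring R" "ideal I R" "module R M" "primeideal p R"
    and "y \<in> I" "ann R (self_module R) y \<subseteq> p"
    and "x \<in> carrier M" "ann R M x = p"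
  obtains h w where "h \<in> module_homs R (ideal_module R I) M" "w \<in> I" "h w \<noteq> \<zero>\<^bsub>M\<^esub>"
proof -
  interpret M: module R M by fact
  interpret N: noetherian_ring R by fact
  interpret I: ideal I R by fact
  interpret p: primeideal p R by fact
  \<comment> \<open>The last condition encodes that I/J does not vanish at \<open>p\<close>: as
    \<open>I\<close> is finitely generated, a vanishing localization would be witnessed by one
    \<open>s\<close> outside \<open>p\<close> for all \<open>w\<close> at once.\<close>
  define S where "S = {J. ideal J R \<and> J \<subseteq> I \<and> \<not> (\<exists>s\<in>carrier R - p. \<forall>w\<in>I. s \<otimes>\<^bsub>R\<^esub> w \<in> J)}"
  \<comment> \<open>The zero ideal belongs to \<open>S\<close>: whatever kills \<open>I\<close>
    kills \<open>y\<close>, hence lies in \<open>p\<close>.\<close>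
  have "s \<in> p" if "s \<in> carrier R" "\<forall>w\<in>I. s \<otimes>\<^bsub>R\<^esub> w \<in> {\<zero>\<^bsub>R\<^esub>}" for s
    using that assms(5,6) by (auto simp: ann_self_module)
  then have "{\<zero>\<^bsub>R\<^esub>} \<in> S"
    using M.R.zeroideal I.zero_closed by (auto simp: S_def)
  then have "S \<noteq> {}" by blast
  then obtain J where J: "J \<in> S" and max: "\<And>K. K \<in> S \<Longrightarrow> J \<subseteq> K \<Longrightarrow> K = J"
    by (rule N.exists_maximal_ideal_in) (auto simp: S_def)
  interpret J: ideal J R using J by (simp add: S_def)
  have one: "\<one>\<^bsub>R\<^esub> \<in> carrier R - p"
    using p.I_notcarr p.one_imp_carrier by auto
  have "J \<noteq> I"
  proof
    assume "J = I"
    then have "\<forall>w\<in>I. \<one>\<^bsub>R\<^esub> \<otimes>\<^bsub>R\<^esub> w \<in> J" using I.Icarr by auto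
    then show False using J one unfolding S_def by blast
  qed
  then obtain z where z: "z \<in> I" "z \<notin> J" using J by (auto simp: S_def)
  then have zc: "z \<in> carrier R" using I.Icarr by blast
  \<comment> \<open>The ideal J + R z lies in \<open>I\<close> and is strictly larger than
    \<open>J\<close>, so by maximality it is not in \<open>S\<close>. This provides the
    \<open>s\<close> outside \<open>p\<close>.\<close>
  let ?K = "J <+>\<^bsub>R\<^esub> PIdl\<^bsub>R\<^esub> z"
  have K_iff: "u \<in> ?K \<longleftrightarrow> (\<exists>j\<in>J. \<exists>r\<in>carrier R. u = j \<oplus>\<^bsub>R\<^esub> r \<otimes>\<^bsub>R\<^esub> z)" for u
    by (auto simp: set_add_def' cgenideal_def)
  have K: "ideal ?K R"
    using M.R.add_ideals[OF J.is_ideal M.R.cgenideal_ideal[OF zc]] .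
  have JK: "J \<subseteq> ?K"
  proof
    fix j assume j: "j \<in> J"
    then have "j = j \<oplus>\<^bsub>R\<^esub> \<zero>\<^bsub>R\<^esub> \<otimes>\<^bsub>R\<^esub> z" using zc J.Icarr by simp
    then show "j \<in> ?K" unfolding K_iff using j M.R.zero_closed by blast
  qed
  have "z = \<zero>\<^bsub>R\<^esub> \<oplus>\<^bsub>R\<^esub> \<one>\<^bsub>R\<^esub> \<otimes>\<^bsub>R\<^esub> z" using zc by simp
  then have "z \<in> ?K" unfolding K_iff using J.zero_closed M.R.one_closed by blast
  then have "?K \<noteq> J" using z by blast
  then have "?K \<notin> S" using max JK by blast
  moreover have "?K \<subseteq> I"
    using J z by (auto simp: K_iff S_def intro!: I.a_closed I.I_l_closed)
  ultimately obtain s where s: "s \<in> carrier R" "s \<notin> p" "\<And>w. w \<in> I \<Longrightarrow> s \<otimes>\<^bsub>R\<^esub> w \<in> ?K"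
    using K unfolding S_def by blast
  \<comment> \<open>If such an \<open>r\<close> were outside \<open>p\<close>, then so would be
    \<open>r s\<close>, since \<open>p\<close> is prime; but \<open>r s\<close> maps all of
    \<open>I\<close> into \<open>J\<close>, against the choice of \<open>J\<close>.\<close>
  have colon: "r \<in> p" if r: "r \<in> carrier R" "r \<otimes>\<^bsub>R\<^esub> z \<in> J" for r
  proof (rule ccontr)
    assume "r \<notin> p"
    then have "r \<otimes>\<^bsub>R\<^esub> s \<in> carrier R - p" using r s p.I_prime by auto
    moreover have "(r \<otimes>\<^bsub>R\<^esub> s) \<otimes>\<^bsub>R\<^esub> w \<in> J" if w: "w \<in> I" for w
    proof -
      obtain j q where jq: "j \<in> J" "q \<in> carrier R" "s \<otimes>\<^bsub>R\<^esub> w = j \<oplus>\<^bsub>R\<^esub> q \<otimes>\<^bsub>R\<^esub> z"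
        using s(3)[OF w] unfolding K_iff by blast
      have "(r \<otimes>\<^bsub>R\<^esub> s) \<otimes>\<^bsub>R\<^esub> w = r \<otimes>\<^bsub>R\<^esub> j \<oplus>\<^bsub>R\<^esub> q \<otimes>\<^bsub>R\<^esub> (r \<otimes>\<^bsub>R\<^esub> z)"
        using r s w jq zc I.Icarr J.Icarr
        by (simp add: M.R.m_assoc M.R.r_distr M.R.m_lcomm)
      then show ?thesis using r jq by (auto intro!: J.a_closed J.I_l_closed)
    qed
    ultimately show False using J unfolding S_def by blast
  qed
  \<comment> \<open>\<open>P w r\<close> makes \<open>r\<close> a coefficient of \<open>z\<close> in
    \<open>s w\<close> modulo \<open>J\<close>. Two such coefficients differ by an element of (J :
    z), which lies in \<open>p\<close>, the annihilator of \<open>x\<close>. So \<open>r x\<close>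
    does not depend on the choice made in \<open>h\<close>.\<close>
  define P where "P w r \<longleftrightarrow> r \<in> carrier R \<and> (\<exists>j\<in>J. s \<otimes>\<^bsub>R\<^esub> w = j \<oplus>\<^bsub>R\<^esub> r \<otimes>\<^bsub>R\<^esub> z)" for w r
  define h where "h w = (SOME r. P w r) \<odot>\<^bsub>M\<^esub> x" for w
  have unique: "r \<odot>\<^bsub>M\<^esub> x = q \<odot>\<^bsub>M\<^esub> x" if "P w r" "P w q" "w \<in> I" for w r q
  proof -
    from that obtain i j where ij: "i \<in> J" "j \<in> J"
        "s \<otimes>\<^bsub>R\<^esub> w = i \<oplus>\<^bsub>R\<^esub> r \<otimes>\<^bsub>R\<^esub> z" "s \<otimes>\<^bsub>R\<^esub> w = j \<oplus>\<^bsub>R\<^esub> q \<otimes>\<^bsub>R\<^esub> z"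
      and rq: "r \<in> carrier R" "q \<in> carrier R" by (auto simp: P_def)
    have ijc: "i \<in> carrier R" "j \<in> carrier R" using ij J.Icarr by auto
    have e: "i \<oplus>\<^bsub>R\<^esub> r \<otimes>\<^bsub>R\<^esub> z = j \<oplus>\<^bsub>R\<^esub> q \<otimes>\<^bsub>R\<^esub> z" using ij by simp
    \<comment> \<open>Adding and subtracting \<open>i\<close> exposes the left side of
      \<open>e\<close>; after rewriting, only \<open>j\<close> minus \<open>i\<close>
      remains.\<close>
    have "(r \<ominus>\<^bsub>R\<^esub> q) \<otimes>\<^bsub>R\<^esub> z = (i \<oplus>\<^bsub>R\<^esub> r \<otimes>\<^bsub>R\<^esub> z) \<ominus>\<^bsub>R\<^esub> i \<ominus>\<^bsub>R\<^esub> q \<otimes>\<^bsub>R\<^esub> z"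
      using rq ijc zc by algebra
    also have "\<dots> = j \<ominus>\<^bsub>R\<^esub> i"
      unfolding e using rq ijc zc by algebra
    finally have "(r \<ominus>\<^bsub>R\<^esub> q) \<otimes>\<^bsub>R\<^esub> z \<in> J"
      using ij by (simp add: a_minus_def J.a_closed J.a_inv_closed)
    then have "r \<ominus>\<^bsub>R\<^esub> q \<in> ann R M x" using colon rq assms(8) by auto
    then have "(r \<ominus>\<^bsub>R\<^esub> q) \<odot>\<^bsub>M\<^esub> x = \<zero>\<^bsub>M\<^esub>" by (simp add: ann_def)
    moreover have "r \<odot>\<^bsub>M\<^esub> x = (r \<ominus>\<^bsub>R\<^esub> q) \<odot>\<^bsub>M\<^esub> x \<oplus>\<^bsub>M\<^esub> q \<odot>\<^bsub>M\<^esub> x"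
    proof -
      have "r = (r \<ominus>\<^bsub>R\<^esub> q) \<oplus>\<^bsub>R\<^esub> q" using rq by algebra
      then show ?thesis using rq assms(7) M.smult_l_distr by (metis M.R.minus_closed)
    qed
    ultimately show ?thesis using rq assms(7) by simp
  qed
  have ex: "\<exists>r. P w r" if "w \<in> I" for w
    using s(3)[OF that] unfolding K_iff P_def by blast
  have h: "h w = r \<odot>\<^bsub>M\<^esub> x" if "P w r" "w \<in> I" for w r
    unfolding h_def using unique[OF someI_ex[OF ex] that(1)] that(2) by blast
  \<comment> \<open>Coefficients for \<open>v\<close> and \<open>w\<close> add up to one for their
    sum, and multiples behave likewise, so independence of the choice gives linearity.\<close>
  have "h \<in> module_homs R (ideal_module R I) M"
    unfolding module_homs_ideal_iff
  proof (intro conjI ballI funcsetI)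
    fix w assume w: "w \<in> I"
    then obtain r where "P w r" using ex by blast
    then show "h w \<in> carrier M" using h w assms(7) by (auto simp: P_def)
  next
    fix v w assume vw: "v \<in> I" "w \<in> I"
    then obtain q r where qr: "P v q" "P w r" using ex by meson
    then obtain i j where ij: "i \<in> J" "j \<in> J"
        "s \<otimes>\<^bsub>R\<^esub> v = i \<oplus>\<^bsub>R\<^esub> q \<otimes>\<^bsub>R\<^esub> z" "s \<otimes>\<^bsub>R\<^esub> w = j \<oplus>\<^bsub>R\<^esub> r \<otimes>\<^bsub>R\<^esub> z"
      and c: "r \<in> carrier R" "q \<in> carrier R" by (auto simp: P_def)
    have ijc: "i \<in> carrier R" "j \<in> carrier R" using ij J.Icarr by auto
    have "s \<otimes>\<^bsub>R\<^esub> (v \<oplus>\<^bsub>R\<^esub> w) = (i \<oplus>\<^bsub>R\<^esub> q \<otimes>\<^bsub>R\<^esub> z) \<oplus>\<^bsub>R\<^esub> (j \<oplus>\<^bsub>R\<^esub> r \<otimes>\<^bsub>R\<^esub> z)"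
      using vw s I.Icarr by (simp add: M.R.r_distr ij)
    also have "\<dots> = (i \<oplus>\<^bsub>R\<^esub> j) \<oplus>\<^bsub>R\<^esub> (q \<oplus>\<^bsub>R\<^esub> r) \<otimes>\<^bsub>R\<^esub> z" using c ijc zc by algebra
    finally have "P (v \<oplus>\<^bsub>R\<^esub> w) (q \<oplus>\<^bsub>R\<^esub> r)"
      using c ij J.a_closed unfolding P_def by blast
    then show "h (v \<oplus>\<^bsub>R\<^esub> w) = h v \<oplus>\<^bsub>M\<^esub> h w"
      using h qr vw c assms(7) by (simp add: I.a_closed M.smult_l_distr)
  next
    fix a w assume aw: "a \<in> carrier R" "w \<in> I"
    then obtain r where r: "P w r" using ex by blast
    then obtain j where j: "j \<in> J" "s \<otimes>\<^bsub>R\<^esub> w = j \<oplus>\<^bsub>R\<^esub> r \<otimes>\<^bsub>R\<^esub> z" and c: "r \<in> carrier R"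
      by (auto simp: P_def)
    have "s \<otimes>\<^bsub>R\<^esub> (a \<otimes>\<^bsub>R\<^esub> w) = a \<otimes>\<^bsub>R\<^esub> (j \<oplus>\<^bsub>R\<^esub> r \<otimes>\<^bsub>R\<^esub> z)"
      using aw s I.Icarr by (simp add: M.R.m_lcomm flip: j(2))
    also have "\<dots> = a \<otimes>\<^bsub>R\<^esub> j \<oplus>\<^bsub>R\<^esub> (a \<otimes>\<^bsub>R\<^esub> r) \<otimes>\<^bsub>R\<^esub> z"
      using aw c j J.Icarr zc by (simp add: M.R.r_distr M.R.m_assoc)
    finally have "P (a \<otimes>\<^bsub>R\<^esub> w) (a \<otimes>\<^bsub>R\<^esub> r)"
      using aw c j J.I_l_closed unfolding P_def by blast
    then show "h (a \<otimes>\<^bsub>R\<^esub> w) = a \<odot>\<^bsub>M\<^esub> h w"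
      using h r aw c assms(7) by (simp add: I.I_l_closed M.smult_assoc1)
  qed
  \<comment> \<open>The element \<open>z\<close> witnesses that \<open>h\<close> is nonzero: it has
    coefficient \<open>s\<close>, and \<open>s x\<close> is nonzero as \<open>s\<close> is outside
    \<open>p\<close>.\<close>
  moreover have "s \<otimes>\<^bsub>R\<^esub> z = \<zero>\<^bsub>R\<^esub> \<oplus>\<^bsub>R\<^esub> s \<otimes>\<^bsub>R\<^esub> z" using s zc by simp
  then have "P z s" using s J.zero_closed unfolding P_def by blast
  then have "h z \<noteq> \<zero>\<^bsub>M\<^esub>" using h z s assms(8) by (auto simp: ann_def)
  ultimately show thesis using that z by blast
qed

section \<open>Cyclic modules\<close>

lemma module_self_module:
  assumes "cring R"
  shows "module R (self_module R)"
proof -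
  interpret cring R by fact
  have "abelian_group (self_module R)"
  proof (rule abelian_groupI)
    fix x assume "x \<in> carrier (self_module R)"
    then show "\<exists>y\<in>carrier (self_module R). y \<oplus>\<^bsub>self_module R\<^esub> x = \<zero>\<^bsub>self_module R\<^esub>"
      by (intro bexI[of _ "\<ominus>\<^bsub>R\<^esub> x"]) (simp_all add: self_module_def l_neg)
  qed (simp_all add: self_module_def a_ac)
  then show ?thesis
    by (intro moduleI is_cring) (auto simp: self_module_def l_distr r_distr m_assoc)
qed

text \<open>Cosets and their sums involve only the addition, which \<open>self_module R\<close>
  shares with \<open>R\<close>. Hence the theory of quotient rings supplies the additive group of
  R/I.\<close>

lemma quot_self_simps:
  "carrier (quot_module (self_module R) I) = carrier (R Quot I)"
  "add (quot_module (self_module R) I) = add (R Quot I)"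
  "zero (quot_module (self_module R) I) = zero (R Quot I)"
  by (simp_all add: quot_module_def self_module_def FactRing_def A_RCOSETS_def RCOSETS_def
      r_coset_def set_add_def set_mult_def fun_eq_iff)

lemma carrier_FactRing: "carrier (R Quot I) = (\<lambda>x. I +>\<^bsub>R\<^esub> x) ` carrier R"
  by (auto simp: FactRing_simps)

text \<open>Scalar multiplication on the quotient is a union over all representatives of a coset.
  They all contribute the same coset, because \<open>r y\<close> and \<open>r x\<close> differ by a
  multiple of an element of \<open>I\<close>.\<close>

lemma quot_self_smult:
  assumes "cring R" "ideal I R" "r \<in> carrier R" "x \<in> carrier R"
  shows "r \<odot>\<^bsub>quot_module (self_module R) I\<^esub> (I +>\<^bsub>R\<^esub> x) = I +>\<^bsub>R\<^esub> (r \<otimes>\<^bsub>R\<^esub> x)"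
proof -
  interpret cring R by fact
  interpret I: ideal I R by fact
  have "I +>\<^bsub>R\<^esub> (r \<otimes>\<^bsub>R\<^esub> y) = I +>\<^bsub>R\<^esub> (r \<otimes>\<^bsub>R\<^esub> x)" if y: "y \<in> I +>\<^bsub>R\<^esub> x" for y
  proof -
    obtain i where i: "i \<in> I" "y = i \<oplus>\<^bsub>R\<^esub> x" using y by (auto simp: a_r_coset_def')
    then have "r \<otimes>\<^bsub>R\<^esub> y \<ominus>\<^bsub>R\<^esub> r \<otimes>\<^bsub>R\<^esub> x = r \<otimes>\<^bsub>R\<^esub> i"
      using assms(3,4) I.Icarr[OF i(1)] unfolding i(2) by algebra
    then have "r \<otimes>\<^bsub>R\<^esub> y \<ominus>\<^bsub>R\<^esub> r \<otimes>\<^bsub>R\<^esub> x \<in> I" using i assms(3) by (simp add: I.I_l_closed)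
    then show ?thesis
      using quotient_eq_iff_same_a_r_cos[OF assms(2)] assms(3,4) i I.Icarr by auto
  qed
  moreover have "x \<in> I +>\<^bsub>R\<^esub> x" using I.a_rcos_self assms(4) by blast
  ultimately have "(\<Union>y\<in>I +>\<^bsub>R\<^esub> x. I +>\<^bsub>R\<^esub> (r \<otimes>\<^bsub>R\<^esub> y)) = I +>\<^bsub>R\<^esub> (r \<otimes>\<^bsub>R\<^esub> x)" by blast
  moreover have "(+>\<^bsub>self_module R\<^esub>) = (+>\<^bsub>R\<^esub>)"
    by (simp add: fun_eq_iff a_r_coset_def r_coset_def self_module_def)
  moreover have "smult (self_module R) = monoid.mult R" by (simp add: self_module_def)
  ultimately show ?thesis by (simp add: quot_module_def)
qed

lemma module_quot_self:
  assumes "cring R" "ideal I R"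
  shows "module R (quot_module (self_module R) I)"
proof -
  interpret cring R by fact
  interpret I: ideal I R by fact
  interpret Q: cring "R Quot I" using I.quotient_is_cring[OF assms(1)] .
  let ?M = "quot_module (self_module R) I"
  have add: "(I +>\<^bsub>R\<^esub> x) \<oplus>\<^bsub>R Quot I\<^esub> (I +>\<^bsub>R\<^esub> y) = I +>\<^bsub>R\<^esub> (x \<oplus>\<^bsub>R\<^esub> y)"
    if "x \<in> carrier R" "y \<in> carrier R" for x y
    using that I.a_rcos_sum by (simp add: FactRing_def)
  have "abelian_group ?M"
  proof (rule abelian_groupI)
    fix x assume "x \<in> carrier ?M"
    then show "\<exists>y\<in>carrier ?M. y \<oplus>\<^bsub>?M\<^esub> x = \<zero>\<^bsub>?M\<^esub>"
      by (intro bexI[of _ "\<ominus>\<^bsub>R Quot I\<^esub> x"]) (simp_all add: quot_self_simps Q.l_neg)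
  qed (simp_all add: quot_self_simps Q.a_ac)
  then show ?thesis
    by (intro moduleI is_cring)
      (auto simp: quot_self_simps carrier_FactRing add quot_self_smult[OF assms]
        l_distr r_distr m_assoc)
qed

section \<open>The first Ext group of a cyclic module\<close>

text \<open>Naturality of the linear extension; it serves to compare a lift to \<open>R\<close> with
  the augmentation to R/I.\<close>

lemma hom_lin_ext:
  assumes "module R M" "module R N" "h \<in> module_homs R M N"
    and "f \<in> carrier (free_mod R B)" "\<phi> \<in> B \<rightarrow> carrier M"
  shows "h (lin_ext R M \<phi> f) = lin_ext R N (\<lambda>b. h (\<phi> b)) f"
proof -
  interpret M: module R M by fact
  interpret N: module R N by fact
  note mem = supp_free_mod[OF assms(4)]
  have "h (\<Oplus>\<^bsub>M\<^esub>b\<in>A. f b \<odot>\<^bsub>M\<^esub> \<phi> b) = (\<Oplus>\<^bsub>N\<^esub>b\<in>A. f b \<odot>\<^bsub>N\<^esub> h (\<phi> b))" if "finite A" "A \<subseteq> B" for A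
    using that
  proof (induction A)
    case empty
    then show ?case using module_homs_zero[OF assms(1-3)] by simp
  next
    case (insert b A)
    have c: "\<phi> c \<in> carrier M" "h (\<phi> c) \<in> carrier N" if "c \<in> insert b A" for c
      using that insert.prems assms(3,5) by (auto simp: module_homs_def)
    have "(\<lambda>c. f c \<odot>\<^bsub>M\<^esub> \<phi> c) \<in> A \<rightarrow> carrier M" "f b \<odot>\<^bsub>M\<^esub> \<phi> b \<in> carrier M"
      "(\<lambda>c. f c \<odot>\<^bsub>N\<^esub> h (\<phi> c)) \<in> A \<rightarrow> carrier N" "f b \<odot>\<^bsub>N\<^esub> h (\<phi> b) \<in> carrier N"
      using c mem(3) by auto
    moreover have "h (f b \<odot>\<^bsub>M\<^esub> \<phi> b) = f b \<odot>\<^bsub>N\<^esub> h (\<phi> b)"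
      using assms(3) c mem(3) by (auto simp: module_homs_def)
    ultimately show ?case
      using insert assms(3) by (auto simp: module_homs_def)
  qed
  then show ?thesis using mem unfolding lin_ext_def by blast
qed

text \<open>In a vanishing quotient the coset of a cocycle is the set of coboundaries itself. As
  zero is a coboundary, the cocycle lies in its own coset.\<close>

lemma cocycles_subset_coboundaries:
  assumes "module R N" "module R (F n)" "d n \<in> carrier (F (Suc n)) \<rightarrow> carrier (F n)"
    and "zero_module (Hom_cohomology R F d N (Suc n))"
  shows "cocycles R F d N (Suc n) \<subseteq> coboundaries R F d N (Suc n)"
proof
  interpret N: module R N by fact
  interpret F: module R "F n" by fact
  let ?B = "coboundaries R F d N (Suc n)" and ?H = "Hom_module R (F (Suc n)) N"
  fix c assume c: "c \<in> cocycles R F d N (Suc n)"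
  then have "?B +>\<^bsub>?H\<lparr>carrier := cocycles R F d N (Suc n)\<rparr>\<^esub> c
      \<in> carrier (Hom_cohomology R F d N (Suc n))"
    by (auto simp: Hom_cohomology_def quot_module_def A_RCOSETS_def' a_r_coset_def)
  then have "?B +>\<^bsub>?H\<lparr>carrier := cocycles R F d N (Suc n)\<rparr>\<^esub> c = ?B"
    using assms(4) by (simp add: zero_module_def) (simp add: Hom_cohomology_def quot_module_def)
  moreover have "\<zero>\<^bsub>?H\<^esub> \<in> ?B"
  proof -
    have "\<zero>\<^bsub>Hom_module R (F n) N\<^esub> \<in> carrier (Hom_module R (F n) N)"
      by (auto simp: Hom_module_def module_homs_def)
    moreover have "\<zero>\<^bsub>?H\<^esub> = codiff F d n \<zero>\<^bsub>Hom_module R (F n) N\<^esub>"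
      using assms(3) by (auto simp: codiff_def compose_def Hom_module_def fun_eq_iff)
    ultimately show ?thesis by simp
  qed
  ultimately have "\<zero>\<^bsub>?H\<^esub> \<oplus>\<^bsub>?H\<^esub> c \<in> ?B"
    by (auto simp: a_r_coset_def' simp del: coboundaries.simps)
  \<comment> \<open>This is an equality of total functions: outside the carrier both sides are
    \<open>undefined\<close>, because cocycles are extensional.\<close>
  moreover have "\<zero>\<^bsub>?H\<^esub> \<oplus>\<^bsub>?H\<^esub> c = c"
    using c by (auto simp: cocycles_def Hom_module_def module_homs_def fun_eq_iff
        extensional_def Pi_iff)
  ultimately show "c \<in> ?B" by simp
qed


text \<open>
  With \<open>g\<close> the lift of the augmentation \<open>F\<^sub>0 \<rightarrow> R/I\<close> to \<open>R\<close>, the map \<open>h \<circ> g \<circ> d\<close> is a 1-cocycle. If it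
  is the coboundary of \<open>\<phi>\<close>, then evaluation at \<open>w\<close> times the generator \<open>1\<close> of \<open>R/I\<close> yields
  \<open>h w = w \<phi>(1) = 0\<close>.
\<close>

lemma hom_ideal_zero_if_Ext1_zero:
  fixes R :: "('a, 'x) ring_scheme"
  assumes "cring R" "ideal I R" "module R N"
    and kill: "\<And>r x. r \<in> I \<Longrightarrow> x \<in> carrier N \<Longrightarrow> r \<odot>\<^bsub>N\<^esub> x = \<zero>\<^bsub>N\<^esub>"
    and Ext: "zero_module (Ext R 1 (quot_module (self_module R) I) N)"
    and h: "h \<in> module_homs R (ideal_module R I) N" and w: "w \<in> I"
  shows "h w = \<zero>\<^bsub>N\<^esub>"
proof -
  interpret cring R by fact
  interpret I: ideal I R by fact
  interpret N: module R N by fact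
  define Q where "Q = quot_module (self_module R) I"
  have Q: "module R Q" unfolding Q_def by (rule module_quot_self[OF assms(1,2)])
  have S: "module R (self_module R)" by (rule module_self_module[OF assms(1)])
  have carQ: "carrier Q = (\<lambda>x. I +>\<^bsub>R\<^esub> x) ` carrier R"
    by (simp add: Q_def quot_self_simps carrier_FactRing)
  have zeroQ: "\<zero>\<^bsub>Q\<^esub> = I" by (simp add: Q_def quot_module_def)
  have proj: "(\<lambda>x. I +>\<^bsub>R\<^esub> x) \<in> module_homs R (self_module R) Q"
    unfolding module_homs_def
    using carQ I.a_rcos_sum quot_self_smult[OF assms(1,2)]
    by (auto simp: Q_def quot_self_simps) (auto simp: self_module_def FactRing_def)
  let ?F = "res_mod R Q" and ?d = "res_diff R" and ?one = "I +>\<^bsub>R\<^esub> \<one>\<^bsub>R\<^esub>"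
  \<comment> \<open>A set-theoretic section of the projection from \<open>R\<close> to R/I. Its
    value at the coset of 1 is fixed to be 1, so that \<open>g\<close> later takes the value 1 on
    the corresponding basis vector.\<close>
  define \<rho> where "\<rho> m = (if m = ?one then \<one>\<^bsub>R\<^esub> else SOME r. r \<in> carrier R \<and> I +>\<^bsub>R\<^esub> r = m)" for m
  have \<rho>: "\<rho> m \<in> carrier R \<and> I +>\<^bsub>R\<^esub> \<rho> m = m" if "m \<in> carrier Q" for m
  proof (cases "m = ?one")
    case False
    have "\<exists>r. r \<in> carrier R \<and> I +>\<^bsub>R\<^esub> r = m" using that carQ by auto
    from someI_ex[OF this] show ?thesis using False by (simp add: \<rho>_def)
  qed (simp add: \<rho>_def)
  define g where "g = lin_ext R (self_module R) (\<lambda>b :: ('a, 'a set) res_gen. \<rho> (gen_val b))"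
  have gens: "(\<lambda>b. \<rho> (gen_val b)) \<in> res_gens R Q 0 \<rightarrow> carrier (self_module R)"
    using \<rho> by (auto simp: self_module_def)
  have g: "g \<in> module_homs R (?F 0) (self_module R)"
    unfolding g_def res_mod_def by (rule lin_ext_hom[OF S gens])
  have aug: "I +>\<^bsub>R\<^esub> g f = res_aug R Q f" if f: "f \<in> carrier (?F 0)" for f
  proof -
    have f': "f \<in> carrier (free_mod R (res_gens R Q 0))" using f by (simp add: res_mod_def)
    interpret Q: module R Q by fact
    have "I +>\<^bsub>R\<^esub> g f = lin_ext R Q (\<lambda>b. I +>\<^bsub>R\<^esub> \<rho> (gen_val b)) f"
      unfolding g_def by (rule hom_lin_ext[OF S Q proj f' gens])
    also have "\<dots> = res_aug R Q f"
      unfolding res_aug_def lin_ext_def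
    proof (rule Q.finsum_cong')
      fix b assume "b \<in> supp R f"
      then have "gen_val b \<in> carrier Q" using supp_free_mod(2)[OF f'] by auto
      then show "f b \<odot>\<^bsub>Q\<^esub> (I +>\<^bsub>R\<^esub> \<rho> (gen_val b)) = f b \<odot>\<^bsub>Q\<^esub> gen_val b" using \<rho> by simp
    qed (use supp_free_mod[OF f'] in auto)
    finally show ?thesis .
  qed
  \<comment> \<open>On the kernel of the augmentation, which is the image of the differential,
    \<open>g\<close> takes values in the domain \<open>I\<close> of \<open>h\<close>. So composing
    with \<open>h\<close> makes sense.\<close>
  have gI: "g f \<in> I" if "f \<in> carrier (?F 0)" "res_aug R Q f = \<zero>\<^bsub>Q\<^esub>" for f
  proof -
    have "g f \<in> carrier R" using g that(1) by (auto simp: module_homs_def self_module_def)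
    moreover have "I +>\<^bsub>R\<^esub> g f = I" using aug that zeroQ by simp
    ultimately show ?thesis using I.a_rcos_self by blast
  qed
  note res = canonical_free_resolution[OF Q, unfolded free_resolution_def]
  have ker: "?d ` carrier (?F (Suc 0)) = {f \<in> carrier (?F 0). res_aug R Q f = \<zero>\<^bsub>Q\<^esub>}"
    and dd: "?d ` carrier (?F (Suc (Suc 0))) = {f \<in> carrier (?F (Suc 0)). ?d f = \<zero>\<^bsub>?F 0\<^esub>}"
    and d: "\<And>n. ?d \<in> module_homs R (?F (Suc n)) (?F n)"
    and F: "\<And>n. module R (?F n)"
    using res by auto
  note hD = h[unfolded module_homs_ideal_iff]
  have gd: "g (?d f) \<in> I" if "f \<in> carrier (?F (Suc 0))" for f using that ker gI by blast
  have h0: "h \<zero>\<^bsub>R\<^esub> = \<zero>\<^bsub>N\<^esub>"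
  proof -
    have "h (\<zero>\<^bsub>R\<^esub> \<otimes>\<^bsub>R\<^esub> \<zero>\<^bsub>R\<^esub>) = \<zero>\<^bsub>R\<^esub> \<odot>\<^bsub>N\<^esub> h \<zero>\<^bsub>R\<^esub>" "h \<zero>\<^bsub>R\<^esub> \<in> carrier N"
      using hD I.zero_closed by blast+
    then show ?thesis by simp
  qed
  \<comment> \<open>The restriction makes \<open>c\<close> extensional, as membership in
    \<open>Hom_module\<close> demands.\<close>
  define c where "c = (\<lambda>f\<in>carrier (?F (Suc 0)). h (g (?d f)))"
  have c_hom: "c \<in> module_homs R (?F (Suc 0)) N"
    unfolding module_homs_def
  proof (intro CollectI conjI ballI funcsetI)
    interpret F1: module R "?F (Suc 0)" by (rule F)
    have dD: "?d e \<in> carrier (?F 0)" if "e \<in> carrier (?F (Suc 0))" for e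
      using d[of 0] that by (auto simp: module_homs_def)
    fix e assume e: "e \<in> carrier (?F (Suc 0))"
    show "c e \<in> carrier N" using e gd hD by (auto simp: c_def)
    show "c (e \<oplus>\<^bsub>?F (Suc 0)\<^esub> f) = c e \<oplus>\<^bsub>N\<^esub> c f" if f: "f \<in> carrier (?F (Suc 0))" for f
    proof -
      have "?d (e \<oplus>\<^bsub>?F (Suc 0)\<^esub> f) = ?d e \<oplus>\<^bsub>?F 0\<^esub> ?d f"
        using d[of 0] e f by (simp add: module_homs_def)
      moreover have "g (?d e \<oplus>\<^bsub>?F 0\<^esub> ?d f) = g (?d e) \<oplus>\<^bsub>R\<^esub> g (?d f)"
        using g dD[OF e] dD[OF f] by (simp add: module_homs_def self_module_def)
      moreover have "h (g (?d e) \<oplus>\<^bsub>R\<^esub> g (?d f)) = h (g (?d e)) \<oplus>\<^bsub>N\<^esub> h (g (?d f))"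
        using hD gd[OF e] gd[OF f] by blast
      ultimately show ?thesis using e f F1.add.m_closed by (simp add: c_def)
    qed
    show "c (r \<odot>\<^bsub>?F (Suc 0)\<^esub> e) = r \<odot>\<^bsub>N\<^esub> c e" if r: "r \<in> carrier R" for r
    proof -
      have "?d (r \<odot>\<^bsub>?F (Suc 0)\<^esub> e) = r \<odot>\<^bsub>?F 0\<^esub> ?d e"
        using d[of 0] e r by (simp add: module_homs_def)
      moreover have "g (r \<odot>\<^bsub>?F 0\<^esub> ?d e) = r \<otimes>\<^bsub>R\<^esub> g (?d e)"
        using g dD[OF e] r by (simp add: module_homs_def self_module_def)
      moreover have "h (r \<otimes>\<^bsub>R\<^esub> g (?d e)) = r \<odot>\<^bsub>N\<^esub> h (g (?d e))"
        using hD gd[OF e] r by blast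
      ultimately show ?thesis using e r F1.smult_closed by (simp add: c_def)
    qed
  qed
  have "c \<in> cocycles R ?F (\<lambda>_. ?d) N (Suc 0)"
  proof -
    have "c (?d e) = \<zero>\<^bsub>N\<^esub>" if "e \<in> carrier (?F (Suc (Suc 0)))" for e
    proof -
      have "?d e \<in> carrier (?F (Suc 0))" "?d (?d e) = \<zero>\<^bsub>?F 0\<^esub>" using that dd by blast+
      moreover have "g \<zero>\<^bsub>?F 0\<^esub> = \<zero>\<^bsub>R\<^esub>"
        using module_homs_zero[OF F S g] by (simp add: self_module_def)
      ultimately show ?thesis using h0 by (simp add: c_def)
    qed
    then have "codiff ?F (\<lambda>_. ?d) (Suc 0) c = \<zero>\<^bsub>Hom_module R (?F (Suc (Suc 0))) N\<^esub>"
      by (auto simp: codiff_def compose_def Hom_module_def fun_eq_iff)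
    moreover have "c \<in> carrier (Hom_module R (?F (Suc 0)) N)"
      using c_hom by (simp add: Hom_module_def c_def)
    ultimately show ?thesis by (simp add: cocycles_def)
  qed
  moreover have "?d \<in> carrier (?F (Suc 0)) \<rightarrow> carrier (?F 0)"
    using d[of 0] by (simp add: module_homs_def)
  moreover have "zero_module (Hom_cohomology R ?F (\<lambda>_. ?d) N (Suc 0))"
    using Ext by (simp add: Ext_def Q_def)
  ultimately have "c \<in> coboundaries R ?F (\<lambda>_. ?d) N (Suc 0)"
    using cocycles_subset_coboundaries[where F = ?F and d = "\<lambda>_. ?d" and n = 0, OF assms(3) F]
    by blast
  then obtain \<phi> where \<phi>: "\<phi> \<in> module_homs R (?F 0) N"
    and c: "c = compose (carrier (?F (Suc 0))) \<phi> ?d"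
    by (auto simp: codiff_def Hom_module_def)
  have one: "?one \<in> carrier Q" using carQ by blast
  then have Gen: "Gen ?one \<in> res_gens R Q 0" by simp
  \<comment> \<open>The basis vector of \<open>?F 0\<close> that belongs to the coset of 1.\<close>
  define u where "u = unit_vec R (Gen ?one :: ('a, 'a set) res_gen)"
  have u: "u \<in> carrier (?F 0)"
    unfolding u_def res_mod_def by (rule unit_vec_carrier[OF assms(1) Gen])
  have wc: "w \<in> carrier R" using w I.Icarr by blast
  have wu: "w \<odot>\<^bsub>?F 0\<^esub> u \<in> carrier (?F 0)"
    using module.smult_closed[OF F wc u] .
  have "g u = \<one>\<^bsub>R\<^esub>"
    unfolding g_def u_def
    using lin_ext_unit_vec[where \<phi> = "\<lambda>b. \<rho> (gen_val b)", OF S Gen]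
    by (simp add: \<rho>_def self_module_def)
  then have gwu: "g (w \<odot>\<^bsub>?F 0\<^esub> u) = w"
    using g wc u by (simp add: module_homs_def self_module_def)
  have "I +>\<^bsub>R\<^esub> w = I" using I.a_rcos_const w by blast
  \<comment> \<open>The augmentation sends \<open>w u\<close> to the coset of \<open>w\<close>,
    which is zero since \<open>w\<close> is in \<open>I\<close>. By exactness \<open>w u\<close> is
    a boundary \<open>?d e\<close>, and \<open>c e\<close> can be computed in two ways.\<close>
  then have "res_aug R Q (w \<odot>\<^bsub>?F 0\<^esub> u) = \<zero>\<^bsub>Q\<^esub>"
    using aug[OF wu] gwu zeroQ by simp
  then obtain e where e: "e \<in> carrier (?F (Suc 0))" "w \<odot>\<^bsub>?F 0\<^esub> u = ?d e"
    using ker wu by blast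
  have "h w = c e" using e gwu by (simp add: c_def)
  also have "\<dots> = \<phi> (w \<odot>\<^bsub>?F 0\<^esub> u)" using e by (simp add: c compose_def)
  also have "\<dots> = w \<odot>\<^bsub>N\<^esub> \<phi> u" using \<phi> wc u by (simp add: module_homs_def)
  also have "\<dots> = \<zero>\<^bsub>N\<^esub>" using \<phi> u w kill by (auto simp: module_homs_def)
  finally show ?thesis .
qed

section \<open>The zero ideal and the conclusion\<close>

lemma free_module_quot_zero:
  assumes "cring R"
  shows "free_module R (quot_module (self_module R) {\<zero>\<^bsub>R\<^esub>})"
proof -
  interpret cring R by fact
  let ?Q = "quot_module (self_module R) {\<zero>\<^bsub>R\<^esub>}" and ?one = "{\<one>\<^bsub>R\<^esub>}"
  interpret Q: module R ?Q by (rule module_quot_self[OF assms zeroideal])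
  \<comment> \<open>Cosets of the zero ideal are singletons, so the coset \<open>?one\<close> of 1
    serves as the basis.\<close>
  have coset: "{\<zero>\<^bsub>R\<^esub>} +>\<^bsub>R\<^esub> x = {x}" if "x \<in> carrier R" for x
    using that by (simp add: a_r_coset_def')
  have car: "carrier ?Q = (\<lambda>x. {x}) ` carrier R"
    using coset by (simp add: quot_self_simps carrier_FactRing)
  have smult: "r \<odot>\<^bsub>?Q\<^esub> {x} = {r \<otimes>\<^bsub>R\<^esub> x}" if "r \<in> carrier R" "x \<in> carrier R" for r x
    using quot_self_smult[OF assms zeroideal that] that coset by simp
  have val: "lin_ext R ?Q (\<lambda>b. b) f = {f ?one}" if f: "f \<in> carrier (free_mod R {?one})" for f
  proof -
    note mem = supp_free_mod[OF f]
    have "lin_ext R ?Q (\<lambda>b. b) f = (\<Oplus>\<^bsub>?Q\<^esub>b\<in>{?one}. f b \<odot>\<^bsub>?Q\<^esub> b)"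
      by (rule lin_ext_superset[OF Q.module_axioms f]) (use car mem in auto)
    then show ?thesis using smult mem(3) car by simp
  qed
  have "bij_betw (lin_ext R ?Q (\<lambda>b. b)) (carrier (free_mod R {?one})) (carrier ?Q)"
  proof (rule bij_betwI')
    fix f g assume f: "f \<in> carrier (free_mod R {?one})" and g: "g \<in> carrier (free_mod R {?one})"
    have "f = g" if "f ?one = g ?one"
    proof
      fix b
      show "f b = g b"
      proof (cases "b = ?one")
        case False
        then have "b \<notin> supp R f" "b \<notin> supp R g"
          using supp_free_mod(2)[OF f] supp_free_mod(2)[OF g] by blast+
        then show ?thesis by (simp add: supp_def)
      qed (simp add: that)
    qed
    then show "(lin_ext R ?Q (\<lambda>b. b) f = lin_ext R ?Q (\<lambda>b. b) g) = (f = g)"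
      using val f g by auto
  next
    fix f assume f: "f \<in> carrier (free_mod R {?one})"
    then show "lin_ext R ?Q (\<lambda>b. b) f \<in> carrier ?Q"
      using val supp_free_mod(3)[OF f] car by auto
  next
    fix m assume "m \<in> carrier ?Q"
    then obtain x where x: "x \<in> carrier R" "m = {x}" using car by auto
    let ?f = "\<lambda>b. if b = ?one then x else \<zero>\<^bsub>R\<^esub>"
    have "?f \<in> carrier (free_mod R {?one})"
      by (rule free_modI[where A = "{?one}"]) (use x in auto)
    then show "\<exists>f\<in>carrier (free_mod R {?one}). m = lin_ext R ?Q (\<lambda>b. b) f"
      using val x by (intro bexI[of _ ?f]) simp_all
  qed
  then show ?thesis unfolding free_module_def using car by (intro exI[of _ "{?one}"]) auto
qed

theorem corollary4p10:
  fixes R :: "('a, 'x) ring_scheme" and I :: "'a set" and M :: "('a, 'a set) module" and t :: enat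
  assumes "cring R" and "noetherian_ring R" and "local_ring R"
    and "ideal I R"
    and "M = quot_module (self_module R) I"
    and "t = depth R M"
    and "Ass R (self_module R) \<subseteq> Ass R M" and "Ass R M = MinSupp R M"
    and "\<And>i. 1 \<le> i \<Longrightarrow> enat i \<le> max 1 t \<Longrightarrow> zero_module (Ext R i M M)"
  shows "free_module R M"
proof -
  interpret cring R by fact
  interpret I: ideal I R by fact
  have M: "module R M" unfolding assms(5) by (rule module_quot_self[OF assms(1,4)])
  have kill: "r \<odot>\<^bsub>M\<^esub> m = \<zero>\<^bsub>M\<^esub>" if r: "r \<in> I" and m: "m \<in> carrier M" for r m
  proof -
    obtain x where x: "x \<in> carrier R" "m = I +>\<^bsub>R\<^esub> x"
      using m by (auto simp: assms(5) quot_self_simps carrier_FactRing)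
    have "r \<odot>\<^bsub>M\<^esub> m = I +>\<^bsub>R\<^esub> (r \<otimes>\<^bsub>R\<^esub> x)"
      unfolding assms(5) x(2) by (rule quot_self_smult[OF assms(1,4) I.Icarr[OF r] x(1)])
    also have "\<dots> = I" using I.a_rcos_const I.I_r_closed[OF r x(1)] by blast
    finally show ?thesis by (simp add: assms(5) quot_module_def)
  qed
  \<comment> \<open>Degree 1 is within the bound max{1, t} for every value of the depth.\<close>
  have Ext: "zero_module (Ext R 1 (quot_module (self_module R) I) M)"
    using assms(9)[of 1] by (simp add: one_enat_def flip: assms(5))
  have "I = {\<zero>\<^bsub>R\<^esub>}"
  proof (rule ccontr)
    assume "I \<noteq> {\<zero>\<^bsub>R\<^esub>}"
    with assms(2,4) obtain y
      where y: "y \<in> I" "ann R (self_module R) y \<in> Ass R (self_module R)"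
      by (rule exists_Ass_ideal)
    \<comment> \<open>The inclusion of the associated primes of \<open>R\<close> in those of
      \<open>M\<close> realizes the annihilator of \<open>y\<close> also as that of some
      \<open>x\<close> in \<open>M\<close>. This prime is the \<open>p\<close> of the homomorphism
      constructed from \<open>I\<close> to \<open>M\<close>.\<close>
    have "ann R (self_module R) y \<in> Ass R M" using assms(7) y(2) by (rule subsetD)
    then obtain x where p: "primeideal (ann R (self_module R) y) R"
      and x: "x \<in> carrier M" "ann R M x = ann R (self_module R) y"
      unfolding Ass_def by blast
    obtain h w where "h \<in> module_homs R (ideal_module R I) M" "w \<in> I" "h w \<noteq> \<zero>\<^bsub>M\<^esub>"
      by (rule exists_nonzero_hom_from_ideal[OF assms(2,4) M p y(1) order_refl x])
    then show False
      using hom_ideal_zero_if_Ext1_zero[OF assms(1,4) M kill Ext] by blast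
  qed
  then show ?thesis using free_module_quot_zero[OF assms(1)] assms(5) by simp
qed

end
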